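(* Let $T:X\to X$, $X=[0,1]^2$, be the baker's transformation with parameter $\gamma\in(0,1/2)$ (and $\alpha=1/2$) defined in the context, and let $\mu$ be its SRB measure. Let $z\in X$ be a periodic point of $T$ of minimal period $p$ for which the limit $$\lim_{r\to0^+}\frac{\log\mu(B(z,r))}{\log r}=d$$ exists ($d$ as in the context). Put $\phi(x)=-\log d_\infty(x,z)$ and $M_n(x):=\max\{\phi(x),\phi(Tx),\dots,\phi(T^{n-1}x)\}$. If $\tau>0$ and the sequence of real numbers $(u_n)$ satisfy $n\,\mu(B(z,e^{-u_n}))\to\tau$ as $n\to\infty$, then $$\lim_{n\to\infty}\mu(M_n\le u_n)=e^{-\theta\tau},\qquad\text{where }\ \theta=1-\alpha^p.$$
   Context: The baker's transformation: fix $\alpha=1/2$ and $\gamma\in(0,1/2)$ (so $\gamma_a=\gamma_b=\gamma$). On $X=[0,1]^2$ put $T(x,y)=(\gamma x,\,2y)$ if $y<1/2$ and $T(x,y)=((1-\gamma)+\gamma x,\,2y-1)$ if $y\ge 1/2$ (the value on the $\mu$-null line $y=1/2$ is a convention). Unstable leaves are the vertical segments $\{x\}\times[0,1]$. The SRB measure $\mu$ is the unique $T$-invariant Borel probability measure on $X$ whose conditional measures on the vertical unstable leaves are normalized Lebesgue (arclength) measure. $d_\infty$ is the $\ell^\infty$ distance on $\mathbb R^2$, $d_\infty((x,y),(x',y'))=\max\{|x-x'|,|y-y'|\}$, and $B(z,r)=\{x\in X:d_\infty(x,z)<r\}$. The number $d=1+\frac{\log2}{\log\gamma^{-1}}$ is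 the Hausdorff dimension of $\mu$. Convention: $-\log0=+\infty$. *)

theory Defs
  imports "HOL-Probability.Probability"
begin

definition square :: "(real \<times> real) set" where
  "square = {0..1} \<times> {0..1}"

text \<open>The baker's transformation with \<open>\<alpha> = 1/2\<close> and \<open>\<gamma>\<^sub>a = \<gamma>\<^sub>b = \<gamma>\<close>. Only its restriction to
  \<^const>\<open>square\<close> is meaningful; it maps the square into itself when \<open>0 < \<gamma> < 1/2\<close>.\<close>

definition baker :: "real \<Rightarrow> real \<times> real \<Rightarrow> real \<times> real" where
  "baker \<gamma> = (\<lambda>(x, y). if y < 1/2 then (\<gamma> * x, 2 * y) else ((1 - \<gamma>) + \<gamma> * x, 2 * y - 1))"

text \<open>Normalized arclength on the unstable leaf \<open>{x} \<times> [0,1]\<close> through the point \<open>w = (x, y)\<close>.\<close>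

definition leaf_lebesgue :: "real \<times> real \<Rightarrow> (real \<times> real) measure" where
  "leaf_lebesgue w =
     distr (restrict_space lborel {0..1}) (restrict_space borel square) (\<lambda>t. (fst w, t))"

text \<open>The SRB measure: a \<open>T\<close>-invariant Borel probability measure on the square whose system of
  conditional measures on the partition into vertical leaves is \<^const>\<open>leaf_lebesgue\<close>. The last
  clause is the disintegration formula; since \<open>leaf_lebesgue w\<close> is constant along leaves and
  carried by the leaf of \<open>w\<close>, applying it to \<open>A \<inter> (E \<times> [0,1])\<close> shows that
  \<open>w \<mapsto> leaf_lebesgue w A\<close> is a version of the conditional probability of \<open>A\<close> given the
  leaf, which determines the conditional measures almost everywhere.\<close>

definition is_SRB :: "real \<Rightarrow> (real \<times> real) measure \<Rightarrow> bool" where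
  "is_SRB \<gamma> \<mu> \<longleftrightarrow>
     prob_space \<mu> \<and>
     sets \<mu> = sets (restrict_space borel square) \<and>
     baker \<gamma> \<in> measurable \<mu> \<mu> \<and>
     distr \<mu> \<mu> (baker \<gamma>) = \<mu> \<and>
     (\<forall>A\<in>sets \<mu>. emeasure \<mu> A = (\<integral>\<^sup>+ w. emeasure (leaf_lebesgue w) A \<partial>\<mu>))"

definition d_inf :: "real \<times> real \<Rightarrow> real \<times> real \<Rightarrow> real" where
  "d_inf v w = max \<bar>fst v - fst w\<bar> \<bar>snd v - snd w\<bar>"

definition sq_ball :: "real \<times> real \<Rightarrow> real \<Rightarrow> (real \<times> real) set" where
  "sq_ball z r = {x \<in> square. d_inf x z < r}"

definition baker_dim :: "real \<Rightarrow> real" where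
  "baker_dim \<gamma> = 1 + ln 2 / ln (inverse \<gamma>)"

definition has_minimal_period :: "('a \<Rightarrow> 'a) \<Rightarrow> 'a \<Rightarrow> nat \<Rightarrow> bool" where
  "has_minimal_period T z p \<longleftrightarrow>
     0 < p \<and> (T ^^ p) z = z \<and> (\<forall>k. 0 < k \<and> k < p \<longrightarrow> (T ^^ k) z \<noteq> z)"

text \<open>Extended-real valued because of the convention \<open>- log 0 = +\<infinity>\<close>
  (whereas \<open>ln 0 = 0\<close> in the library).\<close>

definition obs :: "real \<times> real \<Rightarrow> real \<times> real \<Rightarrow> ereal" where
  "obs z x = (if d_inf x z = 0 then \<infinity> else ereal (- ln (d_inf x z)))"

text \<open>Meaningful for \<open>n \<ge> 1\<close> only, where the maximum is over a nonempty set.\<close>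

definition max_obs ::
    "(real \<times> real \<Rightarrow> real \<times> real) \<Rightarrow> real \<times> real \<Rightarrow> nat \<Rightarrow> real \<times> real \<Rightarrow> ereal" where
  "max_obs T z n x = Max ((\<lambda>i. obs z ((T ^^ i) x)) ` {..<n})"

end

theory Submission
  imports Defs "HOL-Real_Asymp.Real_Asymp"
begin

text \<open>The SRB measure is the product of a self-similar measure on the abscissae and Lebesgue measure.
  Let \<open>B\<close> be the ball of radius \<open>r\<close> and \<open>q n\<close> the probability of not visiting \<open>B\<close> in \<open>n\<close> steps. By
  stationarity \<open>q m - q (m + 1)\<close> is the probability of starting in \<open>B\<close> and then avoiding \<open>B\<close>
  during \<open>m\<close> steps. The map is affine near the periodic point, so the escaping part of \<open>B\<close> (the
  points of \<open>B\<close> outside \<open>B\<close> at time \<open>p\<close>) has measure exactly \<open>\<theta> \<mu>(B)\<close> for small \<open>r\<close>, and it hardly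
  returns within a gap of \<open>2k\<close> steps. After the gap the orbit is almost independent of the start:
  contraction lets one replace the abscissa by \<open>0\<close>, and the doubling map mixes intervals
  exponentially fast. Hence \<open>q (m + 1) \<approx> (1 - \<theta> \<mu>(B)) q m\<close> with error \<open>o(\<mu>(B))\<close>, so
  \<open>q n \<approx> (1 - \<theta> \<mu>(B))\<^sup>n\<close>.\<close>

subsection \<open>Affine structure of the baker map\<close>

text \<open>The action on ordinates, which does not involve the abscissa. As for
  \<open>baker\<close>, 1/2 goes to 0 while 1 stays fixed.\<close>

definition doubling :: "real \<Rightarrow> real" where
  "doubling y = (if y < 1/2 then 2 * y else 2 * y - 1)"

lemma doubling_measurable [measurable]: "doubling \<in> borel \<rightarrow>\<^sub>M borel"
  unfolding doubling_def by measurable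

lemma doubling_iter_measurable [measurable]: "(doubling ^^ k) \<in> borel \<rightarrow>\<^sub>M borel"
  by (rule measurable_compose_n) measurable

lemma baker_measurable [measurable]: "baker \<gamma> \<in> borel \<rightarrow>\<^sub>M borel"
  unfolding baker_def case_prod_beta borel_prod[symmetric] by measurable

lemma baker_iter_measurable [measurable]: "(baker \<gamma> ^^ k) \<in> borel \<rightarrow>\<^sub>M borel"
  by (rule measurable_compose_n) measurable

lemma fst_snd_borel_measurable [measurable]:
  "fst \<in> (borel :: (real \<times> real) measure) \<rightarrow>\<^sub>M borel"
  "snd \<in> (borel :: (real \<times> real) measure) \<rightarrow>\<^sub>M borel"
  by (intro borel_measurable_continuous_onI continuous_intros)+

lemma d_inf_borel_measurable: "(\<lambda>w. d_inf w z) \<in> borel \<rightarrow>\<^sub>M borel"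
  unfolding d_inf_def by measurable

lemmas d_inf_measurable [measurable] = measurable_compose[OF _ d_inf_borel_measurable]

lemma snd_baker: "snd (baker \<gamma> w) = doubling (snd w)"
  by (simp add: baker_def doubling_def split: prod.split)

lemma snd_baker_iter: "snd ((baker \<gamma> ^^ k) w) = (doubling ^^ k) (snd w)"
  by (induction k) (simp_all add: snd_baker)

text \<open>As long as both orbits use the same branch, the translations cancel and only the scaling
  factors of the branches remain.\<close>

lemma baker_iter_diff:
  assumes "\<And>i. i < j \<Longrightarrow> (doubling ^^ i) (snd v) < 1/2 \<longleftrightarrow> (doubling ^^ i) (snd w) < 1/2"
  shows "fst ((baker \<gamma> ^^ j) v) - fst ((baker \<gamma> ^^ j) w) = \<gamma> ^ j * (fst v - fst w)"
    and "(doubling ^^ j) (snd v) - (doubling ^^ j) (snd w) = 2 ^ j * (snd v - snd w)"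
proof -
  have "fst ((baker \<gamma> ^^ j) v) - fst ((baker \<gamma> ^^ j) w) = \<gamma> ^ j * (fst v - fst w) \<and>
    (doubling ^^ j) (snd v) - (doubling ^^ j) (snd w) = 2 ^ j * (snd v - snd w)"
    using assms
  proof (induction j)
    case (Suc j)
    let ?v = "(baker \<gamma> ^^ j) v" and ?w = "(baker \<gamma> ^^ j) w"
    have s: "snd ?v < 1/2 \<longleftrightarrow> snd ?w < 1/2"
      using Suc.prems[of j] by (simp add: snd_baker_iter)
    have IH: "fst ?v - fst ?w = \<gamma> ^ j * (fst v - fst w)"
      "snd ?v - snd ?w = 2 ^ j * (snd v - snd w)"
      using Suc by (simp_all add: snd_baker_iter)
    have "fst (baker \<gamma> ?v) - fst (baker \<gamma> ?w) = \<gamma> * (fst ?v - fst ?w)"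
      using s by (simp add: baker_def case_prod_beta algebra_simps)
    moreover have "doubling (snd ?v) - doubling (snd ?w) = 2 * (snd ?v - snd ?w)"
      using s by (simp add: doubling_def algebra_simps)
    ultimately show ?case
      using IH by (simp add: snd_baker_iter del: right_diff_distrib_numeral)
  qed simp
  then show "fst ((baker \<gamma> ^^ j) v) - fst ((baker \<gamma> ^^ j) w) = \<gamma> ^ j * (fst v - fst w)"
    and "(doubling ^^ j) (snd v) - (doubling ^^ j) (snd w) = 2 ^ j * (snd v - snd w)" by auto
qed

subsection \<open>Mixing of the doubling map\<close>

text \<open>Taken on the whole real line, so that preimages under affine maps need not be cut back
  to the unit interval.\<close>

definition unif :: "real measure" where
  "unif = uniform_measure lborel {0..1}"

lemma sets_unif [measurable_cong, simp]: "sets unif = sets borel"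
  by (simp add: unif_def)

lemma space_unif [simp]: "space unif = UNIV"
  by (simp add: unif_def)

lemma emeasure_unif:
  "F \<in> sets borel \<Longrightarrow> emeasure unif F = emeasure lborel ({0..1} \<inter> F)"
  by (simp add: unif_def divide_ennreal_def)

global_interpretation unif: prob_space unif
  unfolding unif_def by (rule prob_space_uniform_measure) auto

lemma emeasure_lborel_half:
  fixes a b :: real
  assumes [measurable]: "G \<in> sets borel"
  shows "emeasure lborel ({a / 2..b / 2} \<inter> G) = ennreal (1/2) * emeasure lborel ({a..b} \<inter> {y. y / 2 \<in> G})"
proof -
  have "emeasure lborel ({a / 2..b / 2} \<inter> G) = (\<integral>\<^sup>+x. indicator ({a / 2..b / 2} \<inter> G) x \<partial>lborel)"
    by simp
  also have "\<dots> = ennreal (1/2) * (\<integral>\<^sup>+x. indicator ({a / 2..b / 2} \<inter> G) (0 + (1/2) * x) \<partial>lborel)"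
    by (subst nn_integral_real_affine[where c = "1/2" and t = 0]) auto
  also have "(\<lambda>x. indicator ({a / 2..b / 2} \<inter> G) (0 + (1/2) * x)) = 
     (\<lambda>x. indicator ({a..b} \<inter> {y. y / 2 \<in> G}) x :: ennreal)"
    by (auto simp: indicator_def fun_eq_iff)
  finally show ?thesis by simp
qed

text \<open>Cut at 1/2 and rescale both halves: \<open>unif\<close> is the average of its images
  under the two inverse branches of \<open>doubling\<close>.\<close>

lemma unif_halves:
  assumes [measurable]: "G \<in> sets borel"
  shows "measure unif G = (measure unif {y. y / 2 \<in> G} + measure unif {y. (y + 1) / 2 \<in> G}) / 2"
proof -
  have m [measurable]: "(\<lambda>y::real. y / 2) \<in> borel \<rightarrow>\<^sub>M borel" by measurable
  have [measurable]: "{y. y / 2 \<in> G} \<in> sets borel" "{y. (y + 1) / 2 \<in> G} \<in> sets borel"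
    by measurable
  have split: "emeasure lborel ({0..1} \<inter> G) = emeasure lborel ({0..1/2} \<inter> G) + emeasure lborel ({1/2..1} \<inter> G)"
  proof -
    have "emeasure lborel ({0..1} \<inter> G) = emeasure lborel (({0..1/2} \<inter> G) \<union> ({1/2<..1} \<inter> G))"
      by (rule arg_cong[where f = "emeasure lborel"]) auto
    also have "\<dots> = emeasure lborel ({0..1/2} \<inter> G) + emeasure lborel ({1/2<..1} \<inter> G)"
      by (rule plus_emeasure[symmetric]) auto
    also have "emeasure lborel ({1/2<..1} \<inter> G) = emeasure lborel ({1/2..1} \<inter> G)"
      by (rule emeasure_eq_AE) (use AE_lborel_singleton[of "1/2::real"] in \<open>auto elim: eventually_mono\<close>)
    finally show ?thesis .
  qed
  have "emeasure lborel ({1/2..1} \<inter> G) = emeasure lborel ({0..1/2} \<inter> {y. y + 1/2 \<in> G})"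
  proof -
    have "emeasure lborel ({1/2..1} \<inter> G) = (\<integral>\<^sup>+x. indicator ({1/2..1} \<inter> G) x \<partial>lborel)"
      by simp
    also have "\<dots> = (\<integral>\<^sup>+x. indicator ({1/2..1} \<inter> G) (1/2 + 1 * x) \<partial>lborel)"
      by (subst nn_integral_real_affine[where c = 1 and t = "1/2"]) auto
    also have "(\<lambda>x. indicator ({1/2..1} \<inter> G) (1/2 + 1 * x)) = 
       (\<lambda>x. indicator ({0..1/2} \<inter> {y. y + 1/2 \<in> G}) x :: ennreal)"
      by (auto simp: indicator_def fun_eq_iff add.commute)
    finally show ?thesis by simp
  qed
  with split emeasure_lborel_half[of G 0 1] emeasure_lborel_half[of "{y. y + 1/2 \<in> G}" 0 1]
  have "emeasure unif G = ennreal (1/2) * emeasure unif {y. y / 2 \<in> G} 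
      + ennreal (1/2) * emeasure unif {y. (y + 1) / 2 \<in> G}"
    by (simp add: emeasure_unif add_divide_distrib)
  then have "ennreal (measure unif G) = ennreal (1/2 * measure unif {y. y / 2 \<in> G} + 1/2 * measure unif {y. (y + 1) / 2 \<in> G})"
    by (simp add: unif.emeasure_eq_measure flip: ennreal_mult' ennreal_plus del: ennreal_half)
  then show ?thesis
    by (subst (asm) ennreal_inj) (auto simp: field_simps)
qed

lemma AE_unif: "AE y in unif. 0 \<le> y \<and> y < 1"
proof -
  have "AE y in unif. y \<in> {0..1}"
    unfolding unif_def by (rule AE_uniform_measureI) auto
  \<comment> \<open>The point 1 must go: its image 1/2 under the lower inverse branch is sent to 0
    by \<open>doubling\<close>.\<close>
  moreover have "AE y in unif. y \<noteq> 1"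
    unfolding unif_def by (rule AE_uniform_measureI) (use AE_lborel_singleton[of "1::real"] in auto)
  ultimately show ?thesis by eventually_elim auto
qed

lemma unif_doubling_halves:
  assumes [measurable]: "J \<in> sets borel" "F \<in> sets borel"
  shows "measure unif (J \<inter> {y. doubling y \<in> F}) =
    (measure unif ({y. y / 2 \<in> J} \<inter> F) + measure unif ({y. (y + 1) / 2 \<in> J} \<inter> F)) / 2"
proof -
  have [measurable]: "{y. y / 2 \<in> J} \<in> sets borel" "{y. (y + 1) / 2 \<in> J} \<in> sets borel"
    by measurable
  let ?G = "J \<inter> {y. doubling y \<in> F}"
  have [measurable]: "?G \<in> sets borel" by measurable
  have [measurable]: "{y. y / 2 \<in> ?G} \<in> sets borel" "{y. (y + 1) / 2 \<in> ?G} \<in> sets borel"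
    by measurable
  have 1: "measure unif {y. y / 2 \<in> ?G} = measure unif ({y. y / 2 \<in> J} \<inter> F)"
    by (rule measure_eq_AE, use AE_unif in eventually_elim) (auto simp: doubling_def)
  have 2: "measure unif {y. (y + 1) / 2 \<in> ?G} = measure unif ({y. (y + 1) / 2 \<in> J} \<inter> F)"
    by (rule measure_eq_AE, use AE_unif in eventually_elim) (auto simp: doubling_def field_simps)
  show ?thesis
    using unif_halves[of ?G] unfolding 1 2 by simp
qed

text \<open>For a down-closed \<open>J\<close> the preimages under both inverse branches are
  down-closed, and one of them is full or null according to whether 1/2 lies in \<open>J\<close>.
  That one has no discrepancy, so averaging the two halves the error at every step.\<close>

lemma unif_doubling_mixing:
  assumes J [measurable]: "J \<in> sets borel" and F [measurable]: "F \<in> sets borel"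
    and down: "\<And>x y. x \<in> J \<Longrightarrow> y \<le> x \<Longrightarrow> y \<in> J"
  shows "\<bar>measure unif (J \<inter> {y. (doubling ^^ a) y \<in> F}) - measure unif J * measure unif F\<bar>
           \<le> measure unif F / 2 ^ a"
  using J down
proof (induction a arbitrary: J)
  case 0
  note [measurable] = 0(1)
  have "measure unif (J \<inter> F) \<le> measure unif F"
    by (intro unif.finite_measure_mono) auto
  moreover have "measure unif J * measure unif F \<le> measure unif F"
    by (simp add: mult_left_le_one_le)
  ultimately show ?case
    by (simp add: abs_le_iff) (smt (verit) measure_nonneg mult_nonneg_nonneg)
next
  case (Suc a)
  note [measurable] = Suc.prems(1)
  let ?F = "{y. (doubling ^^ a) y \<in> F}"
  let ?d = "\<lambda>J. measure unif (J \<inter> ?F) - measure unif J * measure unif F"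
  define J0 J1 where "J0 = {y. y / 2 \<in> J}" and "J1 = {y. (y + 1) / 2 \<in> J}"
  have meas [measurable]: "J0 \<in> sets borel" "J1 \<in> sets borel" "?F \<in> sets borel"
    unfolding J0_def J1_def by measurable
  \<comment> \<open>Invariance of \<open>unif\<close> makes the discrepancy of a full set vanish
    exactly.\<close>
  have inv: "measure unif ?F = measure unif F"
  proof (induction a)
    case (Suc a)
    then show ?case
      using unif_doubling_halves[of UNIV "{y. (doubling ^^ a) y \<in> F}"]
      by (simp add: funpow_Suc_right del: funpow.simps)
  qed simp
  have IH: "\<bar>?d J0\<bar> \<le> measure unif F / 2 ^ a" "\<bar>?d J1\<bar> \<le> measure unif F / 2 ^ a"
    by (intro Suc.IH meas; use Suc.prems(2) in \<open>force simp: J0_def J1_def\<close>)+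
  have "?d J0 = 0 \<or> ?d J1 = 0"
  proof (cases "1/2 \<in> J")
    case True
    have "AE y in unif. y \<in> J0"
      using AE_unif by eventually_elim (use True Suc.prems(2)[of "1/2"] in \<open>auto simp: J0_def\<close>)
    then have "measure unif J0 = 1" "measure unif (J0 \<inter> ?F) = measure unif ?F"
      using unif.prob_eq_1[of J0] by (auto intro!: measure_eq_AE elim: eventually_mono)
    then show ?thesis using inv unif.prob_space by simp
  next
    case False
    have "AE y in unif. y \<notin> J1"
      using AE_unif by eventually_elim (use False Suc.prems(2) in \<open>force simp: J1_def\<close>)
    then have "measure unif J1 = 0" "measure unif (J1 \<inter> ?F) = 0"
      using unif.prob_eq_0[of J1] unif.prob_eq_0[of "J1 \<inter> ?F"] by (auto elim: eventually_mono)
    then show ?thesis by simp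
  qed
  moreover have "measure unif (J \<inter> {y. (doubling ^^ Suc a) y \<in> F}) =
      (measure unif (J0 \<inter> ?F) + measure unif (J1 \<inter> ?F)) / 2"
    using unif_doubling_halves[of J ?F]
    by (simp add: funpow_Suc_right J0_def J1_def del: funpow.simps)
  moreover have "measure unif J = (measure unif J0 + measure unif J1) / 2"
    unfolding J0_def J1_def by (rule unif_halves) simp
  ultimately have "(?d J0 = 0 \<or> ?d J1 = 0) \<and> measure unif (J \<inter> {y. (doubling ^^ Suc a) y \<in> F})
      - measure unif J * measure unif F = (?d J0 + ?d J1) / 2"
    by (simp only: add_divide_distrib diff_divide_distrib distrib_right) simp
  with IH show ?case by auto
qed

text \<open>The error carries the factor \<open>measure unif F\<close>; when \<open>F\<close> is a
  short interval this yields return bounds proportional to its measure.\<close>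

definition mixing_set :: "real \<Rightarrow> real set \<Rightarrow> bool" where
  "mixing_set c J \<longleftrightarrow> J \<in> sets borel \<and> (\<forall>a. \<forall>F\<in>sets borel.
     \<bar>measure unif (J \<inter> {y. (doubling ^^ a) y \<in> F}) - measure unif J * measure unif F\<bar>
       \<le> c * measure unif F / 2 ^ a)"

lemma mixing_set_downset:
  assumes "J \<in> sets borel" "\<And>x y. x \<in> J \<Longrightarrow> y \<le> x \<Longrightarrow> y \<in> J"
  shows "mixing_set 1 J"
  using unif_doubling_mixing[OF assms(1) _ assms(2)] assms(1) by (auto simp: mixing_set_def)

text \<open>Discrepancies subtract along with the sets, so the constants add.\<close>

lemma mixing_set_Diff:
  assumes "mixing_set c J" "mixing_set d K" "K \<subseteq> J"
  shows "mixing_set (c + d) (J - K)"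
  unfolding mixing_set_def
proof (intro conjI allI ballI)
  have [measurable]: "J \<in> sets borel" "K \<in> sets borel"
    using assms by (auto simp: mixing_set_def)
  show "J - K \<in> sets borel" by measurable
  fix a and F :: "real set" assume F [measurable]: "F \<in> sets borel"
  let ?D = "{y. (doubling ^^ a) y \<in> F}"
  have [measurable]: "?D \<in> sets borel" by measurable
  have "(J - K) \<inter> ?D = J \<inter> ?D - K \<inter> ?D" by auto
  then have "measure unif ((J - K) \<inter> ?D) = measure unif (J \<inter> ?D) - measure unif (K \<inter> ?D)"
    using assms(3) by (auto intro!: unif.finite_measure_Diff)
  moreover have "measure unif (J - K) * measure unif F =
      measure unif J * measure unif F - measure unif K * measure unif F"
    using assms(3) by (simp add: unif.finite_measure_Diff left_diff_distrib)
  moreover have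
    "\<bar>measure unif (J \<inter> ?D) - measure unif J * measure unif F\<bar> \<le> c * measure unif F / 2 ^ a"
    "\<bar>measure unif (K \<inter> ?D) - measure unif K * measure unif F\<bar> \<le> d * measure unif F / 2 ^ a"
    using assms(1,2) F by (auto simp: mixing_set_def)
  ultimately show "\<bar>measure unif ((J - K) \<inter> ?D) - measure unif (J - K) * measure unif F\<bar>
      \<le> (c + d) * measure unif F / 2 ^ a"
    by (simp add: distrib_right add_divide_distrib)
qed

text \<open>An open interval is the difference of two rays, each with constant 1.\<close>

lemma mixing_set_interval: "mixing_set 2 {y. \<bar>y - a\<bar> < s}"
proof (cases "s > 0")
  case True
  have "{y. \<bar>y - a\<bar> < s} = {..<a + s} - {..a - s}" by auto
  moreover have "mixing_set (1 + 1) ({..<a + s} - {..a - s})"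
    using True by (intro mixing_set_Diff mixing_set_downset) auto
  ultimately show ?thesis by simp
next
  case False
  then have "{y. \<bar>y - a\<bar> < s} = {}" by auto
  then show ?thesis by (simp add: mixing_set_def)
qed

lemma (in finite_measure) abs_measure_diff_le:
  assumes "A \<in> sets M" "B \<in> sets M" "D \<in> sets M" "A - B \<subseteq> D" "B - A \<subseteq> D"
  shows "\<bar>measure M A - measure M B\<bar> \<le> measure M D"
proof -
  have "measure M A \<le> measure M (B \<union> D)" "measure M B \<le> measure M (A \<union> D)"
    using assms by (auto intro!: finite_measure_mono)
  then show ?thesis
    using measure_Un_le[of B M D] measure_Un_le[of A M D] assms by linarith
qed

subsection \<open>Structure of the SRB measure\<close>

locale baker_srb =
  fixes \<gamma> :: real and \<mu> :: "(real \<times> real) measure"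
  assumes gamma_pos: "0 < \<gamma>" and gamma_less: "\<gamma> < 1/2" and srb: "is_SRB \<gamma> \<mu>"
begin

sublocale prob_space \<mu>
  using srb by (simp add: is_SRB_def)

lemma sets_mu: "sets \<mu> = sets (restrict_space borel square)"
  using srb by (simp add: is_SRB_def)

lemma square_borel [measurable]: "square \<in> sets borel"
  unfolding square_def by (intro borel_closed closed_Times) auto

lemma space_mu [simp]: "space \<mu> = square"
  using sets_eq_imp_space_eq[OF sets_mu] by simp

lemma sets_muI: "Measurable.pred borel P \<Longrightarrow> {w \<in> square. P w} \<in> sets \<mu>"
  by (auto simp: sets_mu sets_restrict_space_iff)

lemma baker_mu_measurable: "baker \<gamma> \<in> \<mu> \<rightarrow>\<^sub>M \<mu>"
  using srb by (simp add: is_SRB_def)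

lemma baker_iter_in_square: "w \<in> square \<Longrightarrow> (baker \<gamma> ^^ k) w \<in> square"
  using measurable_space[OF baker_mu_measurable] by (induction k) auto

lemma prob_baker_iter:
  assumes [measurable]: "Measurable.pred borel P"
  shows "prob {w \<in> square. P ((baker \<gamma> ^^ k) w)} = prob {w \<in> square. P w}"
proof (induction k)
  case (Suc k)
  have "prob {w \<in> square. P ((baker \<gamma> ^^ k) w)}
      = measure (distr \<mu> \<mu> (baker \<gamma>)) {w \<in> square. P ((baker \<gamma> ^^ k) w)}"
    using srb by (simp add: is_SRB_def)
  also have "\<dots> = prob (baker \<gamma> -` {w \<in> square. P ((baker \<gamma> ^^ k) w)} \<inter> space \<mu>)"
    by (intro measure_distr baker_mu_measurable sets_muI) measurable
  also have "baker \<gamma> -` {w \<in> square. P ((baker \<gamma> ^^ k) w)} \<inter> space \<mu> =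
      {w \<in> square. P ((baker \<gamma> ^^ Suc k) w)}"
    using baker_iter_in_square[of _ 1] by (auto simp: funpow_Suc_right simp del: funpow.simps)
  finally show ?case using Suc by simp
qed simp

text \<open>On the leaf through \<open>w\<close> the rectangle has measure
  \<open>measure unif F\<close> or 0, depending on the abscissa, so the disintegration formula
  becomes a product. Hence the coordinates are independent and the ordinate is uniform.\<close>

lemma prob_rectangle:
  assumes [measurable]: "E \<in> sets borel" "F \<in> sets borel"
  shows "prob {w \<in> square. fst w \<in> E \<and> snd w \<in> F} = prob {w \<in> square. fst w \<in> E} * measure unif F"
proof -
  let ?A = "{w \<in> square. fst w \<in> E \<and> snd w \<in> F}" and ?E = "{w \<in> square. fst w \<in> E}"
  have A: "?A \<in> sets \<mu>" and E: "?E \<in> sets \<mu>" by (intro sets_muI; measurable)+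
  have leaf: "emeasure (leaf_lebesgue w) ?A = emeasure unif F * indicator ?E w" if w: "w \<in> square" for w
  proof -
    have "(\<lambda>t. (fst w, t)) \<in> restrict_space lborel {0..1} \<rightarrow>\<^sub>M restrict_space borel square"
      using w by (intro measurable_restrict_space3)
        (auto simp: square_def mem_Times_iff intro!: borel_measurable_continuous_onI continuous_intros)
    then have "emeasure (leaf_lebesgue w) ?A =
        emeasure (restrict_space lborel {0..1}) ((\<lambda>t. (fst w, t)) -` ?A \<inter> {0..1})"
      using A unfolding leaf_lebesgue_def
      by (subst emeasure_distr) (auto simp: sets_mu space_restrict_space)
    also have "\<dots> = emeasure lborel ((\<lambda>t. (fst w, t)) -` ?A \<inter> {0..1})"
      by (rule emeasure_restrict_space) auto
    also have "(\<lambda>t. (fst w, t)) -` ?A \<inter> {0..1} = (if w \<in> ?E then {0..1} \<inter> F else {})"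
      using w by (auto simp: square_def)
    finally show ?thesis by (auto simp: emeasure_unif indicator_def)
  qed
  have "emeasure \<mu> ?A = (\<integral>\<^sup>+ w. emeasure (leaf_lebesgue w) ?A \<partial>\<mu>)"
    using srb A unfolding is_SRB_def by blast
  also have "\<dots> = (\<integral>\<^sup>+ w. emeasure unif F * indicator ?E w \<partial>\<mu>)"
    by (rule nn_integral_cong) (simp add: leaf)
  also have "\<dots> = emeasure unif F * emeasure \<mu> ?E"
    by (rule nn_integral_cmult_indicator[OF E])
  finally show ?thesis
    by (simp add: measure_def enn2real_mult mult.commute)
qed

lemma prob_snd:
  assumes "F \<in> sets borel"
  shows "prob {w \<in> square. snd w \<in> F} = measure unif F"
  using prob_rectangle[of UNIV F] assms prob_space by simp

section \<open>The self-similar law of the abscissa\<close>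

lemma unif_lower_half: "measure unif {y. y < 1/2} = 1/2" "measure unif {y. \<not> y < 1/2} = 1/2"
proof -
  have "emeasure unif {y. y < 1/2} = emeasure lborel {0..<1/2::real}"
  proof (subst emeasure_unif)
    show "emeasure lborel ({0..1} \<inter> {y::real. y < 1/2}) = emeasure lborel {0..<1/2::real}"
      by (rule arg_cong[where f = "emeasure lborel"]) auto
  qed measurable
  also have "\<dots> = ennreal (1/2)"
    by (subst emeasure_lborel_Ico) auto
  finally have "ennreal (measure unif {y. y < 1/2}) = ennreal (1/2)"
    unfolding unif.emeasure_eq_measure .
  then show *: "measure unif {y. y < 1/2} = 1/2"
    by (subst (asm) ennreal_inj) auto
  show "measure unif {y. \<not> y < 1/2} = 1/2"
    using unif.prob_neg[of "\<lambda>y. y < 1/2"] * by simp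
qed

text \<open>One step moves the abscissa into the left or the right copy according to the half
  containing the ordinate. That choice is fair and independent of the abscissa, and invariance
  closes the equation.\<close>

lemma prob_fst_halves:
  assumes [measurable]: "E \<in> sets borel"
  shows "prob {w \<in> square. fst w \<in> E} =
    (prob {w \<in> square. \<gamma> * fst w \<in> E} + prob {w \<in> square. 1 - \<gamma> + \<gamma> * fst w \<in> E}) / 2"
proof -
  have [measurable]: "{x. \<gamma> * x \<in> E} \<in> sets borel" "{x. 1 - \<gamma> + \<gamma> * x \<in> E} \<in> sets borel"
    by measurable
  have "prob {w \<in> square. fst w \<in> E} = prob {w \<in> square. fst ((baker \<gamma> ^^ 1) w) \<in> E}"
    by (rule prob_baker_iter[symmetric]) measurable
  also have "{w \<in> square. fst ((baker \<gamma> ^^ 1) w) \<in> E} =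
     {w \<in> square. fst w \<in> {x. \<gamma> * x \<in> E} \<and> snd w \<in> {y. y < 1/2}} \<union>
     {w \<in> square. fst w \<in> {x. 1 - \<gamma> + \<gamma> * x \<in> E} \<and> snd w \<in> {y. \<not> y < 1/2}}"
    by (auto simp: baker_def split: if_splits)
  also have "prob \<dots> = prob {w \<in> square. fst w \<in> {x. \<gamma> * x \<in> E} \<and> snd w \<in> {y. y < 1/2}} +
     prob {w \<in> square. fst w \<in> {x. 1 - \<gamma> + \<gamma> * x \<in> E} \<and> snd w \<in> {y. \<not> y < 1/2}}"
    by (rule finite_measure_Union) (auto intro!: sets_muI)
  also have "\<dots> = prob {w \<in> square. fst w \<in> {x. \<gamma> * x \<in> E}} * (1/2) +
      prob {w \<in> square. fst w \<in> {x. 1 - \<gamma> + \<gamma> * x \<in> E}} * (1/2)"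
    by (subst (1 2) prob_rectangle) (simp_all only: unif_lower_half, measurable)
  finally show ?thesis by simp
qed

text \<open>The copies [0, \<gamma>] and [1 - \<gamma>, 1] are separated by a gap of length 1 - 2
  \<gamma>, so a shorter interval meets at most one of them. Passing to that copy magnifies the
  interval by 1/\<gamma> and gains a factor 1/2.\<close>

lemma prob_fst_interval:
  assumes "b - a < (1 - 2 * \<gamma>) * \<gamma> ^ k"
  shows "prob {w \<in> square. fst w \<in> {a..b}} \<le> 1 / 2 ^ k"
  using assms
proof (induction k arbitrary: a b)
  case (Suc k)
  have small: "(b - a) / \<gamma> < (1 - 2 * \<gamma>) * \<gamma> ^ k"
    using Suc.prems gamma_pos by (simp add: field_simps)
  have "(1 - 2 * \<gamma>) * \<gamma> ^ Suc k \<le> (1 - 2 * \<gamma>) * 1"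
    using gamma_pos gamma_less by (intro mult_left_mono power_le_one) auto
  from order_less_le_trans[OF Suc.prems this] have len: "b - a < 1 - 2 * \<gamma>" by simp
  have 0: "{w \<in> square. \<gamma> * fst w \<in> {a..b}} = {w \<in> square. fst w \<in> {a/\<gamma>..b/\<gamma>}}"
    using gamma_pos by (auto simp: field_simps)
  have 1: "{w \<in> square. 1 - \<gamma> + \<gamma> * fst w \<in> {a..b}} =
      {w \<in> square. fst w \<in> {(a - (1 - \<gamma>))/\<gamma>..(b - (1 - \<gamma>))/\<gamma>}}"
    using gamma_pos by (auto simp: field_simps)
  have "prob {w \<in> square. \<gamma> * fst w \<in> {a..b}} \<le> 1 / 2 ^ k"
    unfolding 0 using small by (intro Suc.IH) (simp add: diff_divide_distrib)
  moreover have "prob {w \<in> square. 1 - \<gamma> + \<gamma> * fst w \<in> {a..b}} \<le> 1 / 2 ^ k"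
    unfolding 1 using small by (intro Suc.IH) (simp add: diff_divide_distrib)
  moreover have "prob {w \<in> square. \<gamma> * fst w \<in> {a..b}} = 0 \<or> prob {w \<in> square. 1 - \<gamma> + \<gamma> * fst w \<in> {a..b}} = 0"
  \<comment> \<open>If a \<le> \<gamma> then b < 1 - \<gamma> and the right copy is missed;
    otherwise the left copy is missed.\<close>
  proof (cases "a \<le> \<gamma>")
    case True
    have "1 - \<gamma> + \<gamma> * fst w > b" if "w \<in> square" for w
    proof -
      have "0 \<le> \<gamma> * fst w" using that gamma_pos by (auto simp: square_def)
      then show ?thesis using True len by linarith
    qed
    then have "{w \<in> square. 1 - \<gamma> + \<gamma> * fst w \<in> {a..b}} = {}" by force
    then show ?thesis by (simp only: measure_empty simp_thms)
  next
    case False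
    have "\<gamma> * fst w < a" if "w \<in> square" for w
    proof -
      have "\<gamma> * fst w \<le> \<gamma>"
        using that gamma_pos by (intro mult_left_le) (auto simp: square_def)
      then show ?thesis using False by linarith
    qed
    then have "{w \<in> square. \<gamma> * fst w \<in> {a..b}} = {}" by force
    then show ?thesis by (simp only: measure_empty simp_thms)
  qed
  moreover have "(u + v) / 2 \<le> 1 / 2 ^ Suc k" if "u \<le> 1 / 2 ^ k" "v \<le> 1 / 2 ^ k" "u = 0 \<or> v = 0" for u v :: real
    using that by auto
  ultimately have "(prob {w \<in> square. \<gamma> * fst w \<in> {a..b}} +
       prob {w \<in> square. 1 - \<gamma> + \<gamma> * fst w \<in> {a..b}}) / 2 \<le> 1 / 2 ^ Suc k"
    by blast
  then show ?case by (subst prob_fst_halves) simp_all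
qed simp

lemma prob_fst_near:
  obtains C where "0 < C" "\<And>k a. prob {w \<in> square. \<bar>fst w - a\<bar> \<le> \<gamma> ^ k} \<le> C / 2 ^ k"
proof -
  \<comment> \<open>Choose \<open>c\<close> so that an interval of length 2 \<gamma>^(c+j) is short
    enough for \<open>prob_fst_interval\<close> at level j. The price is the constant 2^c, which
    also makes the bound trivial for k < c.\<close>
  have "(\<lambda>c. 2 * \<gamma> ^ c) \<longlonglongrightarrow> 2 * 0"
    using gamma_pos gamma_less by (intro tendsto_intros LIMSEQ_realpow_zero) auto
  from order_tendstoD(2)[OF this, of "1 - 2 * \<gamma>"]
  have "\<forall>\<^sub>F c in sequentially. 2 * \<gamma> ^ c < 1 - 2 * \<gamma>"
    using gamma_less by simp
  then obtain c where c: "2 * \<gamma> ^ c < 1 - 2 * \<gamma>" by (auto simp: eventually_sequentially)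
  have "prob {w \<in> square. \<bar>fst w - a\<bar> \<le> \<gamma> ^ k} \<le> 2 ^ c / 2 ^ k" for k a
  proof (cases "c \<le> k")
    case True
    then obtain j where j: "k = c + j" using le_Suc_ex by blast
    have "{w \<in> square. \<bar>fst w - a\<bar> \<le> \<gamma> ^ k} = {w \<in> square. fst w \<in> {a - \<gamma> ^ k..a + \<gamma> ^ k}}"
      by auto
    moreover have "prob {w \<in> square. fst w \<in> {a - \<gamma> ^ k..a + \<gamma> ^ k}} \<le> 1 / 2 ^ j"
      using mult_strict_right_mono[OF c, of "\<gamma> ^ j"] gamma_pos
      by (intro prob_fst_interval) (simp add: j power_add)
    ultimately show ?thesis by (simp add: j power_add)
  next
    case False
    have "prob {w \<in> square. \<bar>fst w - a\<bar> \<le> \<gamma> ^ k} \<le> 1" by simp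
    also have "1 \<le> (2::real) ^ c / 2 ^ k" using False by (simp add: power_increasing)
    finally show ?thesis .
  qed
  then show ?thesis using that[of "2 ^ c"] by simp
qed

end

subsection \<open>Survival probabilities\<close>

lemma Pair_zero_snd_measurable [measurable]:
  "(\<lambda>w. (0, snd w)) \<in> (borel :: (real \<times> real) measure) \<rightarrow>\<^sub>M (borel :: (real \<times> real) measure)"
  "(\<lambda>y. (0, y)) \<in> borel \<rightarrow>\<^sub>M (borel :: (real \<times> real) measure)"
  by (intro borel_measurable_continuous_onI continuous_intros)+

lemma mult_abs_diff: "0 \<le> a \<Longrightarrow> a * \<bar>x - y\<bar> = \<bar>a * x - a * y\<bar>" for a :: real
  by (metis abs_mult abs_of_nonneg right_diff_distrib)

lemma abs_diff_chain:
  "\<bar>a - b\<bar> \<le> e \<Longrightarrow> \<bar>b - c\<bar> \<le> f \<Longrightarrow> \<bar>d - c\<bar> \<le> g \<Longrightarrow> \<bar>a - d\<bar> \<le> e + f + g"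
  for a b c d e f g :: real
  by linarith

context baker_srb
begin

definition hit :: "real \<times> real \<Rightarrow> real \<Rightarrow> nat \<Rightarrow> real \<times> real \<Rightarrow> bool" where
  "hit z r i w \<longleftrightarrow> d_inf ((baker \<gamma> ^^ i) w) z < r"

text \<open>A version of \<^term>\<open>hit z r k\<close> that only depends on the vertical coordinate: by contraction, the
  starting abscissa only matters up to \<open>\<gamma>\<^sup>k\<close>.\<close>

definition soft_hit :: "real \<times> real \<Rightarrow> real \<Rightarrow> nat \<Rightarrow> real \<Rightarrow> bool" where
  "soft_hit z r k y \<longleftrightarrow> d_inf ((baker \<gamma> ^^ k) (0, y)) z < r"

definition survival :: "real \<times> real \<Rightarrow> real \<Rightarrow> nat \<Rightarrow> real" where
  "survival z r n = prob {w \<in> square. \<forall>i<n. \<not> hit z r i w}"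

lemma hit_measurable [measurable]: "Measurable.pred borel (hit z r i)"
  unfolding hit_def by measurable

lemma soft_hit_measurable [measurable]: "Measurable.pred borel (soft_hit z r i)"
  unfolding soft_hit_def by measurable

lemma hit_add: "hit z r (a + i) w \<longleftrightarrow> hit z r i ((baker \<gamma> ^^ a) w)"
  by (simp add: hit_def funpow_add add.commute[of a])

lemma hit_0: "hit z r 0 w \<longleftrightarrow> \<bar>fst w - fst z\<bar> < r \<and> \<bar>snd w - snd z\<bar> < r"
  by (simp add: hit_def d_inf_def)

lemma prob_hit: "prob {w \<in> square. hit z r i w} = prob (sq_ball z r)"
proof -
  have "prob {w \<in> square. hit z r 0 ((baker \<gamma> ^^ i) w)} = prob {w \<in> square. hit z r 0 w}"
    by (rule prob_baker_iter) measurable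
  then show ?thesis
    using hit_add[of z r i 0] by (simp add: sq_ball_def hit_def)
qed

lemma survival_shift: "prob {w \<in> square. \<forall>i<n. \<not> hit z r (a + i) w} = survival z r n"
  unfolding survival_def hit_add by (rule prob_baker_iter) measurable

text \<open>After k steps the orbits of \<open>w\<close> and of \<open>(0, snd w)\<close> have the
  same ordinate, and their abscissae differ by at most \<gamma>^k. The two conditions can disagree
  only if the abscissa lies that close to one of the two vertical sides of the ball, and each such
  strip has mass at most C / 2^k.\<close>

lemma prob_hit_neq_soft_hit:
  assumes near: "\<And>k a. prob {w \<in> square. \<bar>fst w - a\<bar> \<le> \<gamma> ^ k} \<le> C / 2 ^ k"
  shows "prob {w \<in> square. hit z r (k + j) w \<noteq> soft_hit z r k ((doubling ^^ j) (snd w))} \<le> 2 * C / 2 ^ k"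
proof -
  let ?near = "\<lambda>a. {w \<in> square. \<bar>fst w - a\<bar> \<le> \<gamma> ^ k}"
  let ?near' = "\<lambda>a. {w \<in> square. \<bar>fst ((baker \<gamma> ^^ k) w) - a\<bar> \<le> \<gamma> ^ k}"
  have "prob {w \<in> square. hit z r (k + j) w \<noteq> soft_hit z r k ((doubling ^^ j) (snd w))}
      = prob {w \<in> square. hit z r k w \<noteq> soft_hit z r k (snd w)}"
    using prob_baker_iter[of "\<lambda>w. hit z r k w \<noteq> soft_hit z r k (snd w)" j]
    by (simp add: add.commute[of k] hit_add snd_baker_iter)
  also have "\<dots> \<le> prob (?near' (fst z + r) \<union> ?near' (fst z - r))"
  proof (rule finite_measure_mono)
    show "{w \<in> square. hit z r k w \<noteq> soft_hit z r k (snd w)} \<subseteq> ?near' (fst z + r) \<union> ?near' (fst z - r)"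
    proof
      fix w assume "w \<in> {w \<in> square. hit z r k w \<noteq> soft_hit z r k (snd w)}"
      moreover obtain x y where xy: "w = (x, y)" by fastforce
      ultimately have w: "(x, y) \<in> square" "hit z r k (x, y) \<noteq> soft_hit z r k y" by auto
      have "fst ((baker \<gamma> ^^ k) (x, y)) - fst ((baker \<gamma> ^^ k) (0, y)) = \<gamma> ^ k * x"
        using baker_iter_diff(1)[of k "(x, y)" "(0, y)" \<gamma>] by simp
      moreover have "0 \<le> \<gamma> ^ k * x" "\<gamma> ^ k * x \<le> \<gamma> ^ k"
        using w(1) gamma_pos by (auto simp: square_def)
      moreover have "snd ((baker \<gamma> ^^ k) (x, y)) = snd ((baker \<gamma> ^^ k) (0, y))"
        by (simp add: snd_baker_iter)
      ultimately have "\<bar>fst ((baker \<gamma> ^^ k) (x, y)) - (fst z + r)\<bar> \<le> \<gamma> ^ k \<or>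
          \<bar>fst ((baker \<gamma> ^^ k) (x, y)) - (fst z - r)\<bar> \<le> \<gamma> ^ k"
        using w(2) unfolding hit_def soft_hit_def d_inf_def by (auto simp: abs_if split: if_splits)
      then show "w \<in> ?near' (fst z + r) \<union> ?near' (fst z - r)"
        using w(1) xy by simp
    qed
  next
    show "?near' (fst z + r) \<union> ?near' (fst z - r) \<in> events"
      by (intro sets.Un sets_muI) measurable
  qed
  also have "\<dots> \<le> prob (?near' (fst z + r)) + prob (?near' (fst z - r))"
    by (intro measure_Un_le sets_muI) measurable
  also have "\<dots> = prob (?near (fst z + r)) + prob (?near (fst z - r))"
    by (intro arg_cong2[where f = "(+)"] prob_baker_iter) measurable
  also have "\<dots> \<le> C / 2 ^ k + C / 2 ^ k"
    by (intro add_mono near)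
  finally show ?thesis by simp
qed

text \<open>Union bound over the window. After the replacement, avoidance is a condition on the
  ordinate at time \<open>a\<close> alone.\<close>

lemma survival_approx:
  assumes near: "\<And>k a. prob {w \<in> square. \<bar>fst w - a\<bar> \<le> \<gamma> ^ k} \<le> C / 2 ^ k"
    and P [measurable]: "Measurable.pred borel P"
  shows "\<bar>prob {w \<in> square. P w \<and> (\<forall>i<m. \<not> hit z r (k + (a + i)) w)} -
          prob {w \<in> square. P w \<and> (\<forall>i<m. \<not> soft_hit z r k ((doubling ^^ (a + i)) (snd w)))}\<bar>
         \<le> real m * (2 * C / 2 ^ k)"
proof -
  let ?D = "\<lambda>i. {w \<in> square. hit z r (k + (a + i)) w \<noteq> soft_hit z r k ((doubling ^^ (a + i)) (snd w))}"
  have D: "?D i \<in> events" for i by (rule sets_muI) measurable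
  have "\<bar>prob {w \<in> square. P w \<and> (\<forall>i<m. \<not> hit z r (k + (a + i)) w)} -
          prob {w \<in> square. P w \<and> (\<forall>i<m. \<not> soft_hit z r k ((doubling ^^ (a + i)) (snd w)))}\<bar>
        \<le> prob (\<Union>i<m. ?D i)"
    using D by (intro abs_measure_diff_le sets_muI sets.finite_UN) (measurable, auto)
  also have "\<dots> \<le> (\<Sum>i<m. prob (?D i))"
    using D by (intro finite_measure_subadditive_finite) auto
  also have "\<dots> \<le> (\<Sum>i<m. 2 * C / 2 ^ k)"
    by (intro sum_mono prob_hit_neq_soft_hit near)
  finally show ?thesis by simp
qed

text \<open>The first \<open>a\<close> steps decorrelate the ordinate and the next \<open>k\<close>
  forget the abscissa. Three errors are collected: softening the joint event, mixing of
  \<open>doubling\<close>, and undoing the softening for the survival probability; the two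
  softenings together give 4 C.\<close>

lemma survival_mixing:
  assumes near: "\<And>k a. prob {w \<in> square. \<bar>fst w - a\<bar> \<le> \<gamma> ^ k} \<le> C / 2 ^ k"
    and I [measurable]: "I \<in> sets borel" and J: "mixing_set c J" and c: "0 \<le> c"
  defines "E \<equiv> \<lambda>w. fst w \<in> I \<and> snd w \<in> J"
  shows "\<bar>prob {w \<in> square. E w \<and> (\<forall>i<m. \<not> hit z r (k + (a + i)) w)} -
          prob {w \<in> square. E w} * survival z r m\<bar> \<le> real m * (4 * C / 2 ^ k) + c / 2 ^ a"
proof -
  have [measurable]: "J \<in> sets borel" using J by (simp add: mixing_set_def)
  define F where "F = {y. \<forall>i<m. \<not> soft_hit z r k ((doubling ^^ i) y)}"
  have F [measurable]: "F \<in> sets borel" unfolding F_def by measurable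
  let ?nu = "prob {w \<in> square. fst w \<in> I}"
  have "Measurable.pred borel E" unfolding E_def by measurable
  from survival_approx[OF near this, of m z r k a]
  have 1: "\<bar>prob {w \<in> square. E w \<and> (\<forall>i<m. \<not> hit z r (k + (a + i)) w)} -
          prob {w \<in> square. E w \<and> (doubling ^^ a) (snd w) \<in> F}\<bar> \<le> real m * (2 * C / 2 ^ k)"
    by (simp add: F_def funpow_add add.commute[of a])
  have "{w \<in> square. E w \<and> (doubling ^^ a) (snd w) \<in> F}
      = {w \<in> square. fst w \<in> I \<and> snd w \<in> J \<inter> {y. (doubling ^^ a) y \<in> F}}"
    by (auto simp: E_def)
  then have 2: "prob {w \<in> square. E w \<and> (doubling ^^ a) (snd w) \<in> F}
      = ?nu * measure unif (J \<inter> {y. (doubling ^^ a) y \<in> F})"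
    using prob_rectangle[of I "J \<inter> {y. (doubling ^^ a) y \<in> F}"] by simp
  have E: "prob {w \<in> square. E w} = ?nu * measure unif J"
    unfolding E_def by (rule prob_rectangle) measurable
  have "\<bar>measure unif (J \<inter> {y. (doubling ^^ a) y \<in> F}) - measure unif J * measure unif F\<bar>
      \<le> c * measure unif F / 2 ^ a"
    using J F by (auto simp: mixing_set_def)
  also have "\<dots> \<le> c / 2 ^ a"
    using c by (intro divide_right_mono mult_left_le) auto
  finally have "?nu * \<bar>measure unif (J \<inter> {y. (doubling ^^ a) y \<in> F}) - measure unif J * measure unif F\<bar>
      \<le> 1 * (c / 2 ^ a)"
    by (intro mult_mono) auto
  also have "?nu * \<bar>measure unif (J \<inter> {y. (doubling ^^ a) y \<in> F}) - measure unif J * measure unif F\<bar> =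
    \<bar>?nu * measure unif (J \<inter> {y. (doubling ^^ a) y \<in> F}) - prob {w \<in> square. E w} * measure unif F\<bar>"
    unfolding E by (simp add: mult_abs_diff mult.assoc)
  finally have 3: "\<bar>?nu * measure unif (J \<inter> {y. (doubling ^^ a) y \<in> F}) -
      prob {w \<in> square. E w} * measure unif F\<bar> \<le> c / 2 ^ a" by simp
  \<comment> \<open>With the trivial \<open>P\<close> and \<open>a = 0\<close>, stationarity
    identifies the window starting at time k with \<open>survival z r m\<close>.\<close>
  have "\<bar>survival z r m - measure unif F\<bar> \<le> real m * (2 * C / 2 ^ k)"
    using survival_approx[OF near, of "\<lambda>_. True" m z r k 0] survival_shift[of m z r k] prob_snd[OF F]
    by (simp add: F_def)
  then have "prob {w \<in> square. E w} * \<bar>survival z r m - measure unif F\<bar> \<le> 1 * (real m * (2 * C / 2 ^ k))"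
    by (intro mult_mono) auto
  also have "prob {w \<in> square. E w} * \<bar>survival z r m - measure unif F\<bar> =
      \<bar>prob {w \<in> square. E w} * survival z r m - prob {w \<in> square. E w} * measure unif F\<bar>"
    by (simp add: mult_abs_diff)
  finally have "\<bar>prob {w \<in> square. E w} * survival z r m - prob {w \<in> square. E w} * measure unif F\<bar>
      \<le> real m * (2 * C / 2 ^ k)" by simp
  from abs_diff_chain[OF 1[unfolded 2] 3 this] show ?thesis by (simp add: mult_ac)
qed

section \<open>The recursion for survival probabilities\<close>

lemma survival_0: "survival z r 0 = 1"
  using prob_space by (simp add: survival_def)

lemma survival_bounds: "0 \<le> survival z r n" "survival z r n \<le> 1"
  by (simp_all add: survival_def)

lemma survival_Suc:
  "survival z r (Suc n) = survival z r n - prob {w \<in> square. hit z r 0 w \<and> (\<forall>i<n. \<not> hit z r (1 + i) w)}"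
proof -
  have "{w \<in> square. \<forall>i<Suc n. \<not> hit z r i w} = {w \<in> square. \<forall>i<n. \<not> hit z r (1 + i) w} -
      {w \<in> square. hit z r 0 w \<and> (\<forall>i<n. \<not> hit z r (1 + i) w)}"
    by (auto simp: less_Suc_eq_0_disj)
  then have "survival z r (Suc n) = prob {w \<in> square. \<forall>i<n. \<not> hit z r (1 + i) w} -
      prob {w \<in> square. hit z r 0 w \<and> (\<forall>i<n. \<not> hit z r (1 + i) w)}"
    unfolding survival_def by (auto intro!: finite_measure_Diff sets_muI)
  then show ?thesis using survival_shift[of n z r 1] by simp
qed

text \<open>By stationarity, each lengthening of the window by one step loses at most the mass of
  the ball.\<close>

lemma survival_add:
  "\<bar>survival z r n - survival z r (n + l)\<bar> \<le> real l * prob (sq_ball z r)"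
proof (induction l)
  case (Suc l)
  have "prob {w \<in> square. hit z r 0 w \<and> (\<forall>i<n + l. \<not> hit z r (1 + i) w)} \<le> prob {w \<in> square. hit z r 0 w}"
    by (intro finite_measure_mono sets_muI) auto
  then have "\<bar>survival z r (n + l) - survival z r (n + Suc l)\<bar> \<le> prob (sq_ball z r)"
    using survival_Suc[of z r "n + l"] by (simp add: prob_hit)
  with Suc show ?case by (simp add: algebra_simps)
qed simp

text \<open>For a start in the ball, the window from 1 to m is split at time 2k. In the gap only
  avoidance at time p is kept, which defines the escaping part; all other returns are paid for by
  \<open>S\<close>. The rest is nearly independent by \<open>survival_mixing\<close> with a = k, and
  restoring the shortened window to length m costs the quadratic term.\<close>

lemma survival_step:
  assumes near: "\<And>k a. prob {w \<in> square. \<bar>fst w - a\<bar> \<le> \<gamma> ^ k} \<le> C / 2 ^ k"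
    and I [measurable]: "I \<in> sets borel" and J: "mixing_set c J" and c: "0 \<le> c"
    and p: "0 < p" "p < 2 * k" and m: "2 * k \<le> m"
    and E: "\<And>w. w \<in> square \<Longrightarrow> fst w \<in> I \<and> snd w \<in> J \<longleftrightarrow> hit z r 0 w \<and> \<not> hit z r p w"
    and S: "(\<Sum>j\<in>{1..<2*k}-{p}. prob {w \<in> square. hit z r 0 w \<and> \<not> hit z r p w \<and> hit z r j w}) \<le> S"
  shows "\<bar>survival z r m - survival z r (Suc m) -
            prob {w \<in> square. hit z r 0 w \<and> \<not> hit z r p w} * survival z r m\<bar>
         \<le> S + real m * (4 * C / 2 ^ k) + c / 2 ^ k + 2 * real k * prob (sq_ball z r) ^ 2"
proof -
  \<comment> \<open>\<open>l\<close> counts the times from 2k to m inclusive.\<close>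
  obtain l where l: "m + 1 = 2 * k + l" using m le_Suc_ex[of "2 * k" "m + 1"] by auto
  have [measurable]: "J \<in> sets borel" using J by (simp add: mixing_set_def)
  let ?E = "\<lambda>w. hit z r 0 w \<and> \<not> hit z r p w"
  let ?S0 = "{w \<in> square. hit z r 0 w \<and> (\<forall>i<m. \<not> hit z r (1 + i) w)}"
  let ?S1 = "{w \<in> square. ?E w \<and> (\<forall>i<l. \<not> hit z r (k + (k + i)) w)}"
  let ?D = "\<lambda>j. {w \<in> square. hit z r 0 w \<and> \<not> hit z r p w \<and> hit z r j w}"
  have D: "?D i \<in> events" for i by (rule sets_muI) measurable
  have "\<bar>prob ?S0 - prob ?S1\<bar> \<le> prob (\<Union>j\<in>{1..<2*k}-{p}. ?D j)"
  proof (rule abs_measure_diff_le)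
    have "\<not> hit z r p w" if "w \<in> ?S0" for w
      using that p m by (auto dest!: spec[of _ "p - 1"])
    moreover have "\<not> hit z r (k + (k + i)) w" if "w \<in> ?S0" "i < l" for w i
    proof -
      have "k + k + i - 1 < m" "1 + (k + k + i - 1) = k + (k + i)" using that p l by auto
      then show ?thesis using that(1) by (auto dest!: spec[of _ "k + k + i - 1"])
    qed
    ultimately show "?S0 - ?S1 \<subseteq> (\<Union>j\<in>{1..<2*k}-{p}. ?D j)" by auto
    show "?S1 - ?S0 \<subseteq> (\<Union>j\<in>{1..<2*k}-{p}. ?D j)"
    proof
      fix w assume w: "w \<in> ?S1 - ?S0"
      then obtain i where i: "i < m" "hit z r (1 + i) w" by auto
      have "1 + i < 2 * k"
      proof (rule ccontr)
        assume *: "\<not> 1 + i < 2 * k"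
        then have "1 + i - 2 * k < l" "k + (k + (1 + i - 2 * k)) = 1 + i" using i l by auto
        then show False using w i by (metis (no_types, lifting) Diff_iff mem_Collect_eq)
      qed
      moreover have "1 + i \<noteq> p" using w i by auto
      ultimately show "w \<in> (\<Union>j\<in>{1..<2*k}-{p}. ?D j)" using w i by auto
    qed
  qed (use D in \<open>auto intro!: sets_muI\<close>)
  also have "\<dots> \<le> (\<Sum>j\<in>{1..<2*k}-{p}. prob (?D j))"
    using D by (intro finite_measure_subadditive_finite) auto
  also have "\<dots> \<le> S" by (rule S)
  finally have 1: "\<bar>prob ?S0 - prob ?S1\<bar> \<le> S" .
  have eq: "{w \<in> square. fst w \<in> I \<and> snd w \<in> J} = {w \<in> square. ?E w}"
    "{w \<in> square. (fst w \<in> I \<and> snd w \<in> J) \<and> (\<forall>i<l. \<not> hit z r (k + (k + i)) w)} = ?S1"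
    using E by blast+
  have "\<bar>prob ?S1 - prob {w \<in> square. ?E w} * survival z r l\<bar> \<le> real l * (4 * C / 2 ^ k) + c / 2 ^ k"
    using survival_mixing[OF near I J c, of l z r k k] unfolding eq .
  also have "real l * (4 * C / 2 ^ k) \<le> real m * (4 * C / 2 ^ k)"
  proof -
    have "0 \<le> C / 2 ^ 0" by (rule order_trans[OF measure_nonneg near[of 0 0]])
    then show ?thesis using l p by (intro mult_right_mono) auto
  qed
  finally have 2: "\<bar>prob ?S1 - prob {w \<in> square. ?E w} * survival z r l\<bar> \<le> real m * (4 * C / 2 ^ k) + c / 2 ^ k"
    by simp
  have "\<bar>survival z r l - survival z r m\<bar> \<le> real (2 * k - 1) * prob (sq_ball z r)"
  proof -
    have "l + (2 * k - 1) = m" using l p by auto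
    then show ?thesis using survival_add[of z r l "2 * k - 1"] by simp
  qed
  also have "\<dots> \<le> 2 * real k * prob (sq_ball z r)"
    by (intro mult_right_mono) auto
  finally have "prob {w \<in> square. ?E w} * \<bar>survival z r l - survival z r m\<bar>
      \<le> prob (sq_ball z r) * (2 * real k * prob (sq_ball z r))"
    unfolding prob_hit[of z r 0, symmetric]
    by (intro mult_mono) (auto intro!: finite_measure_mono sets_muI)
  also have "prob {w \<in> square. ?E w} * \<bar>survival z r l - survival z r m\<bar> =
     \<bar>prob {w \<in> square. ?E w} * survival z r l - prob {w \<in> square. ?E w} * survival z r m\<bar>"
    by (simp add: mult_abs_diff)
  finally have 3: "\<bar>prob {w \<in> square. ?E w} * survival z r l - prob {w \<in> square. ?E w} * survival z r m\<bar>
     \<le> 2 * real k * prob (sq_ball z r) ^ 2"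
    by (simp add: power2_eq_square mult_ac)
  have "prob ?S0 = survival z r m - survival z r (Suc m)"
    using survival_Suc[of z r m] by simp
  with 1 2 3 show ?thesis by linarith
qed

text \<open>The factor 1 - e lies between 0 and 1, so one-step errors add up without amplification.
  During the first 2k steps the window is too short for the gap argument, and the crude error
  \<open>prob (sq_ball z r)\<close> is used instead.\<close>

lemma survival_geometric:
  assumes near: "\<And>k a. prob {w \<in> square. \<bar>fst w - a\<bar> \<le> \<gamma> ^ k} \<le> C / 2 ^ k"
    and I [measurable]: "I \<in> sets borel" and J: "mixing_set c J" and c: "0 \<le> c"
    and p: "0 < p" "p < 2 * k"
    and E: "\<And>w. w \<in> square \<Longrightarrow> fst w \<in> I \<and> snd w \<in> J \<longleftrightarrow> hit z r 0 w \<and> \<not> hit z r p w"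
    and S: "(\<Sum>j\<in>{1..<2*k}-{p}. prob {w \<in> square. hit z r 0 w \<and> \<not> hit z r p w \<and> hit z r j w}) \<le> S"
  shows "\<bar>survival z r n - (1 - prob {w \<in> square. hit z r 0 w \<and> \<not> hit z r p w}) ^ n\<bar>
         \<le> real n * (S + real n * (4 * C / 2 ^ k) + c / 2 ^ k + 2 * real k * prob (sq_ball z r) ^ 2)
            + 2 * real k * prob (sq_ball z r)"
proof -
  let ?b = "prob (sq_ball z r)" and ?e = "prob {w \<in> square. hit z r 0 w \<and> \<not> hit z r p w}"
  let ?err = "S + real n * (4 * C / 2 ^ k) + c / 2 ^ k + 2 * real k * ?b ^ 2"
  have C: "0 \<le> C" using order_trans[OF measure_nonneg near[of 0 0]] by simp
  have "0 \<le> (\<Sum>j\<in>{1..<2*k}-{p}. prob {w \<in> square. hit z r 0 w \<and> \<not> hit z r p w \<and> hit z r j w})"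
    by (intro sum_nonneg) auto
  with S have S0: "0 \<le> S" by linarith
  have err: "0 \<le> ?err"
    using C c S0 by (intro add_nonneg_nonneg mult_nonneg_nonneg divide_nonneg_nonneg) auto
  have e: "0 \<le> ?e" "?e \<le> ?b" "?e \<le> 1"
    unfolding prob_hit[of z r 0, symmetric] by (auto intro!: finite_measure_mono sets_muI)
  have step: "\<bar>survival z r (Suc m) - (1 - ?e) * survival z r m\<bar> \<le> ?err + (if m < 2 * k then ?b else 0)"
    if "m \<le> n" for m
  proof (cases "m < 2 * k")
    case True
    have "\<bar>survival z r m - survival z r (Suc m)\<bar> \<le> ?b"
      using survival_add[of z r m 1] by simp
    moreover have "survival z r (Suc m) \<le> survival z r m"
      using survival_Suc[of z r m] by simp
    moreover have "0 \<le> ?e * survival z r m" "?e * survival z r m \<le> ?b"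
      using e survival_bounds[of z r m] mult_mono[of ?e ?b "survival z r m" 1] by auto
    ultimately show ?thesis using True err by (simp add: left_diff_distrib)
  next
    case False
    then have "2 * k \<le> m" by simp
    from survival_step[OF near I J c p this E S]
    have "\<bar>survival z r m - survival z r (Suc m) - ?e * survival z r m\<bar>
       \<le> S + real m * (4 * C / 2 ^ k) + c / 2 ^ k + 2 * real k * ?b ^ 2" .
    also have "\<dots> \<le> ?err"
      using that C by (intro add_mono mult_right_mono) auto
    finally show ?thesis using False by (simp add: left_diff_distrib abs_le_iff)
  qed
  \<comment> \<open>\<open>min m K\<close> counts the early steps, which carry the additional error
    b.\<close>
  have rec: "x + (if m < K then b else 0) + (real m * x + real (min m K) * b)
      = real (Suc m) * x + real (min (Suc m) K) * b" for x b :: real and m K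
    by (auto simp: algebra_simps min_def)
  have "\<bar>survival z r m - (1 - ?e) ^ m\<bar> \<le> real m * ?err + real (min m (2 * k)) * ?b" if "m \<le> n" for m
    using that
  proof (induction m)
    case 0
    then show ?case by (simp add: survival_0)
  next
    case (Suc m)
    have "\<bar>(1 - ?e) * survival z r m - (1 - ?e) ^ Suc m\<bar> = (1 - ?e) * \<bar>survival z r m - (1 - ?e) ^ m\<bar>"
      using e by (simp add: mult_abs_diff)
    also have "\<dots> \<le> 1 * \<bar>survival z r m - (1 - ?e) ^ m\<bar>"
      using e by (intro mult_right_mono) auto
    also have "\<dots> \<le> real m * ?err + real (min m (2 * k)) * ?b" using Suc by simp
    finally have "\<bar>survival z r (Suc m) - (1 - ?e) ^ Suc m\<bar> \<le>
        ?err + (if m < 2 * k then ?b else 0) + (real m * ?err + real (min m (2 * k)) * ?b)"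
      using step[of m] Suc.prems by linarith
    also have "\<dots> = real (Suc m) * ?err + real (min (Suc m) (2 * k)) * ?b"
      by (rule rec)
    finally show ?case .
  qed
  from this[of n] have "\<bar>survival z r n - (1 - ?e) ^ n\<bar> \<le> real n * ?err + real (min n (2 * k)) * ?b"
    by simp
  also have "real (min n (2 * k)) * ?b \<le> 2 * real k * ?b"
    by (intro mult_right_mono) auto
  finally show ?thesis by simp
qed

end

subsection \<open>Returns near a periodic point\<close>

text \<open>An orbit through 1/2 falls onto the fixed point 0 and cannot come back. Hence the choice
  of branch is locally constant along a periodic orbit.\<close>

lemma doubling_periodic_neq_half:
  assumes "(doubling ^^ p) y = y" "0 < p"
  shows "(doubling ^^ j) y \<noteq> 1/2"
proof
  assume half: "(doubling ^^ j) y = 1/2"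
  obtain i where i: "p = Suc i" using assms(2) gr0_implies_Suc by blast
  have "(doubling ^^ i) 0 = 0" by (induction i) (simp_all add: doubling_def)
  moreover have "(doubling ^^ j) ((doubling ^^ p) y) = (doubling ^^ i) (doubling ((doubling ^^ j) y))"
    unfolding i by (metis add.commute comp_apply funpow_add funpow_Suc_right)
  ultimately show False using half assms(1) by (simp add: doubling_def)
qed

lemma doubling_itinerary_near:
  assumes "\<And>j. j < K \<Longrightarrow> (doubling ^^ j) y \<noteq> 1/2"
  obtains \<delta> where "\<delta> > 0"
    "\<And>x j. \<bar>x - y\<bar> < \<delta> \<Longrightarrow> j < K \<Longrightarrow> (doubling ^^ j) x < 1/2 \<longleftrightarrow> (doubling ^^ j) y < 1/2"
proof -
  have "\<exists>\<delta>>0. \<forall>x j. \<bar>x - y\<bar> < \<delta> \<longrightarrow> j < K \<longrightarrow> ((doubling ^^ j) x < 1/2 \<longleftrightarrow> (doubling ^^ j) y < 1/2)"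
    using assms
  proof (induction K)
    case 0
    show ?case by (rule exI[of _ 1]) simp
  next
    case (Suc K)
    then obtain \<delta> where \<delta>: "\<delta> > 0"
      "\<And>x j. \<bar>x - y\<bar> < \<delta> \<Longrightarrow> j < K \<Longrightarrow> (doubling ^^ j) x < 1/2 \<longleftrightarrow> (doubling ^^ j) y < 1/2"
      by (metis less_SucI)
    \<comment> \<open>While the branches agree, the distance grows to 2^K times its initial value at
      time K; it must stay below the distance from the orbit of \<open>y\<close> to 1/2.\<close>
    define \<delta>' where "\<delta>' = min \<delta> (\<bar>(doubling ^^ K) y - 1/2\<bar> / 2 ^ K)"
    have "(doubling ^^ j) x < 1/2 \<longleftrightarrow> (doubling ^^ j) y < 1/2" if x: "\<bar>x - y\<bar> < \<delta>'" and j: "j < Suc K" for x j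
    proof (cases "j = K")
      case True
      have "(doubling ^^ K) x - (doubling ^^ K) y = 2 ^ K * (x - y)"
        using baker_iter_diff(2)[of K "(0, x)" "(0, y)"] \<delta>(2)[of x] x by (simp add: \<delta>'_def)
      moreover have "\<bar>2 ^ K * (x - y)\<bar> < \<bar>(doubling ^^ K) y - 1/2\<bar>"
        using x unfolding abs_mult by (simp add: \<delta>'_def pos_less_divide_eq mult.commute)
      ultimately show ?thesis unfolding True by linarith
    next
      case False
      then show ?thesis using \<delta>(2)[of x j] x j by (simp add: \<delta>'_def)
    qed
    moreover have "\<delta>' > 0" using \<delta>(1) Suc.prems[of K] by (simp add: \<delta>'_def)
    ultimately show ?case by blast
  qed
  then show ?thesis using that by blast
qed

lemma minimal_period_dvd:
  assumes "has_minimal_period f z p" "(f ^^ j) z = z"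
  shows "p dvd j"
proof -
  have "(f ^^ (j mod p)) z = z"
    using assms funpow_mod_eq[of p f z j] by (simp add: has_minimal_period_def)
  moreover have "j mod p < p" using assms(1) by (simp add: has_minimal_period_def)
  ultimately have "j mod p = 0"
    using assms(1) unfolding has_minimal_period_def by (metis neq0_conv)
  then show ?thesis by auto
qed

lemma measure_unif: "F \<in> sets borel \<Longrightarrow> measure unif F = measure lborel ({0..1} \<inter> F)"
  by (simp add: measure_def emeasure_unif)

lemma unif_interval_le:
  assumes "0 < s"
  shows "measure unif {y. \<bar>y - a\<bar> < s} \<le> 2 * s"
proof -
  have "measure unif {y. \<bar>y - a\<bar> < s} = measure lborel ({0..1} \<inter> {y. \<bar>y - a\<bar> < s})"
    by (intro measure_unif) measurable
  also have "\<dots> \<le> measure lborel {a - s..a + s}"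
    by (rule measure_mono_fmeasurable) (auto simp: fmeasurable_def emeasure_lborel_Icc_eq)
  finally show ?thesis using assms by simp
qed

text \<open>The constant is 1 at the endpoints and 2 inside. The endpoints do occur, since the
  corners (0,0) and (1,1) are fixed points. Exact proportionality later makes the escaping fraction
  exactly 1 - 2^-p.\<close>

lemma unif_interval_proportional:
  assumes "0 \<le> a" "a \<le> 1"
  obtains c \<delta> where "0 < \<delta>" "\<And>s. 0 < s \<Longrightarrow> s < \<delta> \<Longrightarrow> measure unif {y. \<bar>y - a\<bar> < s} = c * s"
proof -
  have *: "measure unif {y. \<bar>y - a\<bar> < s} = measure lborel ({0..1} \<inter> {y. \<bar>y - a\<bar> < s})" for s
    by (intro measure_unif) measurable
  consider "a = 0" | "a = 1" | "0 < a" "a < 1" using assms by linarith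
  then show ?thesis
  proof cases
    case 1
    have "{0..1} \<inter> {y. \<bar>y - a\<bar> < s} = {0..<s}" if "s < 1" for s using that 1 by auto
    then show ?thesis using that[of 1 1] * by simp
  next
    case 2
    have "{0..1} \<inter> {y. \<bar>y - a\<bar> < s} = {1-s<..1}" if "s < 1" for s using that 2 by auto
    then show ?thesis using that[of 1 1] * by simp
  next
    case 3
    have "{0..1} \<inter> {y. \<bar>y - a\<bar> < s} = {a-s<..<a+s}" if "s < min a (1 - a)" for s using that by auto
    then show ?thesis using that[of "min a (1 - a)" 2] * 3 by simp
  qed
qed

lemma sum_half_powers_tail:
  "(\<Sum>j<N. if K < j then 1 / 2 ^ j else 0) = (if N \<le> K then 0 else 1 / 2 ^ K - 2 / 2 ^ N :: real)"
proof (induction N)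
  case (Suc N)
  consider "N < K" | "N = K" | "K < N" by linarith
  then show ?case by cases (auto simp: Suc)
qed simp

context baker_srb
begin

section \<open>Return and escape probabilities of small balls\<close>

lemma prob_sq_ball:
  "prob (sq_ball z r) = prob {w \<in> square. fst w \<in> {x. \<bar>x - fst z\<bar> < r}} * measure unif {y. \<bar>y - snd z\<bar> < r}"
proof -
  have "sq_ball z r = {w \<in> square. fst w \<in> {x. \<bar>x - fst z\<bar> < r} \<and> snd w \<in> {y. \<bar>y - snd z\<bar> < r}}"
    by (auto simp: sq_ball_def d_inf_def)
  moreover have "prob {w \<in> square. fst w \<in> {x. \<bar>x - fst z\<bar> < r} \<and> snd w \<in> {y. \<bar>y - snd z\<bar> < r}}
     = prob {w \<in> square. fst w \<in> {x. \<bar>x - fst z\<bar> < r}} * measure unif {y. \<bar>y - snd z\<bar> < r}"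
    by (intro prob_rectangle) measurable
  ultimately show ?thesis by simp
qed

text \<open>At time j only the ordinate condition is kept. Decorrelating the interval
  \<open>?J\<close> from itself bounds its returning fraction by its own measure, at most 2 r, plus
  the mixing error 2 / 2^j.\<close>

lemma prob_return:
  assumes r: "0 < r"
  shows "prob {w \<in> square. hit z r 0 w \<and> hit z r j w} \<le> prob (sq_ball z r) * (2 * r + 2 / 2 ^ j)"
proof -
  let ?I = "{x. \<bar>x - fst z\<bar> < r}" and ?J = "{y. \<bar>y - snd z\<bar> < r}"
  let ?D = "{y. (doubling ^^ j) y \<in> ?J}"
  let ?nu = "prob {w \<in> square. fst w \<in> ?I}"
  have J: "?J \<in> sets borel" by measurable
  have "prob {w \<in> square. hit z r 0 w \<and> hit z r j w} \<le> prob {w \<in> square. fst w \<in> ?I \<and> snd w \<in> ?J \<inter> ?D}"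
    by (intro finite_measure_mono sets_muI)
      (measurable, auto simp: hit_0 hit_def[of z r j] d_inf_def snd_baker_iter)
  also have "\<dots> = ?nu * measure unif (?J \<inter> ?D)"
    by (intro prob_rectangle) measurable
  also have "\<dots> \<le> ?nu * (measure unif ?J * (2 * r + 2 / 2 ^ j))"
  proof (intro mult_left_mono)
    have "\<bar>measure unif (?J \<inter> ?D) - measure unif ?J * measure unif ?J\<bar> \<le> 2 * measure unif ?J / 2 ^ j"
      using mixing_set_interval J unfolding mixing_set_def by blast
    moreover have "measure unif ?J * measure unif ?J \<le> measure unif ?J * (2 * r)"
      by (intro mult_left_mono unif_interval_le r) auto
    ultimately show "measure unif (?J \<inter> ?D) \<le> measure unif ?J * (2 * r + 2 / 2 ^ j)"
      by (simp add: distrib_left abs_le_iff mult.commute)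
  qed simp
  finally show ?thesis by (simp add: prob_sq_ball mult.assoc)
qed

text \<open>Close to a periodic point the iterates up to time \<open>K\<close> are affine, so the only early returns
  happen along multiples of the period, and each of them passes through a return at time \<open>p\<close>.\<close>

lemma near_periodic_point:
  assumes z: "z \<in> square" and per: "has_minimal_period (baker \<gamma>) z p" and K: "p \<le> K"
  obtains \<delta> where "0 < \<delta>"
    "\<And>r w. r < \<delta> \<Longrightarrow> hit z r 0 w \<Longrightarrow> hit z r p w \<longleftrightarrow> \<bar>snd w - snd z\<bar> < r / 2 ^ p"
    "\<And>r w j. r < \<delta> \<Longrightarrow> hit z r 0 w \<Longrightarrow> \<not> hit z r p w \<Longrightarrow> 0 < j \<Longrightarrow> j \<le> K \<Longrightarrow> \<not> hit z r j w"
proof -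
  have p: "0 < p" and Tp: "(baker \<gamma> ^^ p) z = z" using per by (auto simp: has_minimal_period_def)
  then have "(doubling ^^ p) (snd z) = snd z" by (metis snd_baker_iter)
  then have "(doubling ^^ j) (snd z) \<noteq> 1/2" for j by (rule doubling_periodic_neq_half[OF _ p])
  then obtain \<delta> where \<delta>: "\<delta> > 0" "\<And>y j. \<bar>y - snd z\<bar> < \<delta> \<Longrightarrow> j < K \<Longrightarrow>
      (doubling ^^ j) y < 1/2 \<longleftrightarrow> (doubling ^^ j) (snd z) < 1/2"
    using doubling_itinerary_near[of K "snd z"] by blast
  \<comment> \<open>\<open>e\<close> separates \<open>z\<close> from its orbit at the times up to K
    that are not multiples of p; the inserted 1 keeps the set nonempty.\<close>
  define e where "e = Min (insert 1 ((\<lambda>j. d_inf ((baker \<gamma> ^^ j) z) z) ` {j. j \<le> K \<and> \<not> p dvd j}))"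
  have "0 < d_inf ((baker \<gamma> ^^ j) z) z" if "\<not> p dvd j" for j
    using that minimal_period_dvd[OF per, of j] by (auto simp: d_inf_def less_max_iff_disj prod_eq_iff)
  then have e: "0 < e" "\<And>j. j \<le> K \<Longrightarrow> \<not> p dvd j \<Longrightarrow> e \<le> d_inf ((baker \<gamma> ^^ j) z) z"
    unfolding e_def by auto
  have affine: "fst ((baker \<gamma> ^^ j) w) - fst ((baker \<gamma> ^^ j) z) = \<gamma> ^ j * (fst w - fst z)"
    "snd ((baker \<gamma> ^^ j) w) - snd ((baker \<gamma> ^^ j) z) = 2 ^ j * (snd w - snd z)"
    if "r < \<delta>" "hit z r 0 w" "j \<le> K" for r w j
    using that \<delta>(2)[of "snd w"] baker_iter_diff[of j w z] by (simp_all add: hit_0 snd_baker_iter)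
  have contract: "\<bar>\<gamma> ^ j * (fst w - fst z)\<bar> < r" if "hit z r 0 w" for r w j
  proof -
    have "\<bar>\<gamma> ^ j * (fst w - fst z)\<bar> \<le> 1 * \<bar>fst w - fst z\<bar>"
      unfolding abs_mult using gamma_pos gamma_less by (intro mult_right_mono) (auto simp: power_le_one)
    then show ?thesis using that by (simp add: hit_0)
  qed
  \<comment> \<open>Horizontally the return is automatic by contraction, so the vertical expansion
    alone decides.\<close>
  have first: "hit z r p w \<longleftrightarrow> \<bar>snd w - snd z\<bar> < r / 2 ^ p" if "r < \<delta>" "hit z r 0 w" for r w
  proof -
    have "hit z r p w \<longleftrightarrow> 2 ^ p * \<bar>snd w - snd z\<bar> < r"
      using contract[OF that(2), of p] affine[OF that K, unfolded Tp]
      by (simp add: hit_def d_inf_def abs_mult)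
    then show ?thesis by (simp add: pos_less_divide_eq mult.commute)
  qed
  \<comment> \<open>Up to time K the orbits of \<open>w\<close> and \<open>z\<close> stay within 2^K
    r of each other, and a hit adds r \<le> 2^K r; the second bound on \<open>r\<close> keeps the
    sum below \<open>e\<close>.\<close>
  have later: "\<not> hit z r j w"
    if r: "r < \<delta>" "r < e / (2 * 2 ^ K)" and w: "hit z r 0 w" "\<not> hit z r p w" and j: "0 < j" "j \<le> K" for r w j
  proof
    assume hit: "hit z r j w"
    note aff = affine[OF r(1) w(1) j(2)]
    show False
    proof (cases "p dvd j")
      case True
      then obtain l where "j = p * l" by blast
      then have "(baker \<gamma> ^^ j) z = z"
        using funpow_mod_eq[OF Tp, of j] by simp
      then have "2 ^ j * \<bar>snd w - snd z\<bar> < r"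
        using hit aff by (simp add: hit_def d_inf_def abs_mult)
      \<comment> \<open>The vertical deviation grows with time, so a return at a multiple of p
        forces one at p itself.\<close>
      moreover have "2 ^ p * \<bar>snd w - snd z\<bar> \<le> 2 ^ j * \<bar>snd w - snd z\<bar>"
        using dvd_imp_le[OF True j(1)] by (intro mult_right_mono power_increasing) auto
      ultimately have "2 ^ p * \<bar>snd w - snd z\<bar> < r" by linarith
      then show False using first[OF r(1) w(1)] w(2) by (simp add: field_simps)
    next
      case False
      have "2 ^ j * \<bar>snd w - snd z\<bar> \<le> 2 ^ K * r"
        using w(1) j by (intro mult_mono) (auto simp: hit_0)
      then have "\<bar>2 ^ j * (snd w - snd z)\<bar> \<le> 2 ^ K * r" by (simp add: abs_mult)
      moreover have "0 < r" using w(1) by (auto simp: hit_0)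
      then have "r \<le> 2 ^ K * r" using mult_right_mono[of 1 "2 ^ K" r] by simp
      moreover note contract[OF w(1), of j]
      ultimately have "d_inf ((baker \<gamma> ^^ j) z) z < 2 ^ K * r + 2 ^ K * r"
        using hit aff unfolding hit_def d_inf_def by linarith
      also have "\<dots> < e" using r(2) by (simp add: field_simps)
      finally show False using e(2)[OF j(2) False] by simp
    qed
  qed
  show ?thesis
  proof (rule that[of "min \<delta> (e / (2 * 2 ^ K))"])
    show "0 < min \<delta> (e / (2 * 2 ^ K))" using \<delta>(1) e(1) by simp
  qed (use first later in auto)
qed

text \<open>Up to time K no term contributes. Afterwards \<open>prob_return\<close> leaves a term
  linear in r for each of fewer than 2k times, and a geometric tail of at most 2 / 2^K.\<close>

lemma sum_prob_returns:
  assumes r: "0 < r"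
    and none: "\<And>j w. w \<in> square \<Longrightarrow> hit z r 0 w \<Longrightarrow> \<not> hit z r p w \<Longrightarrow> 0 < j \<Longrightarrow> j \<le> K \<Longrightarrow> \<not> hit z r j w"
  shows "(\<Sum>j\<in>{1..<2*k}-{p}. prob {w \<in> square. hit z r 0 w \<and> \<not> hit z r p w \<and> hit z r j w})
     \<le> prob (sq_ball z r) * (4 * real k * r + 2 / 2 ^ K)"
proof -
  let ?b = "prob (sq_ball z r)"
  let ?f = "\<lambda>j. ?b * (2 * r) + 2 * ?b * (if K < j then 1 / 2 ^ j else 0)"
  have "prob {w \<in> square. hit z r 0 w \<and> \<not> hit z r p w \<and> hit z r j w} \<le> ?f j" if "0 < j" for j
  proof (cases "K < j")
    case True
    have "prob {w \<in> square. hit z r 0 w \<and> \<not> hit z r p w \<and> hit z r j w}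
        \<le> prob {w \<in> square. hit z r 0 w \<and> hit z r j w}"
      by (intro finite_measure_mono sets_muI) (measurable, auto)
    also have "\<dots> \<le> ?b * (2 * r + 2 / 2 ^ j)" by (rule prob_return[OF r])
    finally show ?thesis using True by (simp add: distrib_left mult.commute)
  next
    case False
    then have "{w \<in> square. hit z r 0 w \<and> \<not> hit z r p w \<and> hit z r j w} = {}"
      using none that by auto
    then show ?thesis using False r by (simp only: measure_empty) simp
  qed
  then have "(\<Sum>j\<in>{1..<2*k}-{p}. prob {w \<in> square. hit z r 0 w \<and> \<not> hit z r p w \<and> hit z r j w})
      \<le> (\<Sum>j\<in>{1..<2*k}-{p}. ?f j)"
    by (intro sum_mono) auto
  also have "\<dots> \<le> (\<Sum>j<2*k. ?f j)"
    using r by (intro sum_mono2) auto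
  also have "\<dots> = ?b * (4 * real k * r) + 2 * ?b * (\<Sum>j<2*k. if K < j then 1 / 2 ^ j else 0)"
    unfolding sum.distrib sum_distrib_left[symmetric] by simp
  also have "\<dots> \<le> ?b * (4 * real k * r) + 2 * ?b * (1 / 2 ^ K)"
    unfolding sum_half_powers_tail by (intro add_left_mono mult_left_mono) auto
  finally show ?thesis by (simp add: distrib_left mult.commute)
qed

text \<open>The escaping part is a rectangle over the difference of two concentric intervals, hence
  the mixing constant 4; their radii r and r / 2^p give exactly the fraction 1 - 2^-p. The threshold
  for r depends on K but not on k or n, which may therefore grow as r shrinks.\<close>

lemma survival_estimate:
  assumes near: "\<And>k a. prob {w \<in> square. \<bar>fst w - a\<bar> \<le> \<gamma> ^ k} \<le> C / 2 ^ k"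
    and z: "z \<in> square" and per: "has_minimal_period (baker \<gamma>) z p" and K: "p \<le> K"
  obtains \<delta> where "0 < \<delta>"
    "\<And>r k n. 0 < r \<Longrightarrow> r < \<delta> \<Longrightarrow> p < 2 * k \<Longrightarrow>
      \<bar>survival z r n - (1 - (1 - (1/2) ^ p) * prob (sq_ball z r)) ^ n\<bar>
        \<le> real n * (prob (sq_ball z r) * (4 * real k * r + 2 / 2 ^ K) + real n * (4 * C / 2 ^ k)
             + 4 / 2 ^ k + 2 * real k * prob (sq_ball z r) ^ 2)
          + 2 * real k * prob (sq_ball z r)"
proof -
  have p: "0 < p" using per by (simp add: has_minimal_period_def)
  obtain \<delta> where \<delta>: "0 < \<delta>"
    "\<And>r w. r < \<delta> \<Longrightarrow> hit z r 0 w \<Longrightarrow> hit z r p w \<longleftrightarrow> \<bar>snd w - snd z\<bar> < r / 2 ^ p"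
    "\<And>r w j. r < \<delta> \<Longrightarrow> hit z r 0 w \<Longrightarrow> \<not> hit z r p w \<Longrightarrow> 0 < j \<Longrightarrow> j \<le> K \<Longrightarrow> \<not> hit z r j w"
    using near_periodic_point[OF z per K] by blast
  have "0 \<le> snd z" "snd z \<le> 1" using z by (auto simp: square_def)
  then obtain c \<epsilon> where c: "0 < \<epsilon>"
    "\<And>s. 0 < s \<Longrightarrow> s < \<epsilon> \<Longrightarrow> measure unif {y. \<bar>y - snd z\<bar> < s} = c * s"
    using unif_interval_proportional by metis
  show ?thesis
  proof (rule that[of "min \<delta> \<epsilon>"])
    show "0 < min \<delta> \<epsilon>" using \<delta>(1) c(1) by simp
  next
    fix r :: real and k n :: nat
    assume r: "0 < r" "r < min \<delta> \<epsilon>" and k: "p < 2 * k"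
    let ?I = "{x. \<bar>x - fst z\<bar> < r}" and ?J = "\<lambda>s. {y. \<bar>y - snd z\<bar> < s}"
    let ?A = "?J r - ?J (r / 2 ^ p)"
    have s: "0 < r / 2 ^ p" "r / 2 ^ p \<le> r"
      using r by (auto simp: field_simps)
    have I: "?I \<in> sets borel" by measurable
    have sub: "?J (r / 2 ^ p) \<subseteq> ?J r" using s by auto
    have A: "mixing_set (2 + 2) ?A"
      by (intro mixing_set_Diff mixing_set_interval sub)
    have E: "fst w \<in> ?I \<and> snd w \<in> ?A \<longleftrightarrow> hit z r 0 w \<and> \<not> hit z r p w" for w
      using \<delta>(2)[of r w] r by (auto simp: hit_0)
    have "prob {w \<in> square. hit z r 0 w \<and> \<not> hit z r p w} = prob {w \<in> square. fst w \<in> ?I \<and> snd w \<in> ?A}"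
      by (simp only: E)
    also have "\<dots> = prob {w \<in> square. fst w \<in> ?I} * measure unif ?A"
      by (intro prob_rectangle) measurable
    also have "measure unif ?A = measure unif (?J r) - measure unif (?J (r / 2 ^ p))"
      using sub by (intro unif.finite_measure_Diff) auto
    also have "\<dots> = (1 - (1/2) ^ p) * measure unif (?J r)"
      using c(2)[of r] c(2)[of "r / 2 ^ p"] r s by (simp add: algebra_simps power_one_over)
    finally have e: "prob {w \<in> square. hit z r 0 w \<and> \<not> hit z r p w} = (1 - (1/2) ^ p) * prob (sq_ball z r)"
      unfolding prob_sq_ball by simp
    have S: "(\<Sum>j\<in>{1..<2*k}-{p}. prob {w \<in> square. hit z r 0 w \<and> \<not> hit z r p w \<and> hit z r j w})
       \<le> prob (sq_ball z r) * (4 * real k * r + 2 / 2 ^ K)"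
      using \<delta>(3) r by (intro sum_prob_returns) auto
    from survival_geometric[OF near I A _ p k E S, of n]
    show "\<bar>survival z r n - (1 - (1 - (1/2) ^ p) * prob (sq_ball z r)) ^ n\<bar>
        \<le> real n * (prob (sq_ball z r) * (4 * real k * r + 2 / 2 ^ K) + real n * (4 * C / 2 ^ k)
             + 4 / 2 ^ k + 2 * real k * prob (sq_ball z r) ^ 2)
          + 2 * real k * prob (sq_ball z r)"
      unfolding e by simp
  qed
qed

text \<open>The non-strict inequality for the observable matches avoidance of the open ball. An
  orbit through \<open>z\<close> has infinite observable and counts as a hit.\<close>

lemma max_obs_le_iff:
  assumes "0 < n"
  shows "max_obs (baker \<gamma>) z n w \<le> ereal u \<longleftrightarrow> (\<forall>i<n. \<not> hit z (exp (- u)) i w)"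
proof -
  have "obs z x \<le> ereal u \<longleftrightarrow> \<not> d_inf x z < exp (- u)" for x
  proof (cases "d_inf x z = 0")
    case False
    then have "0 < d_inf x z" by (auto simp: d_inf_def)
    then have "- ln (d_inf x z) \<le> u \<longleftrightarrow> exp (- u) \<le> d_inf x z"
      by (subst ln_ge_iff[symmetric]) auto
    then show ?thesis using False by (auto simp: obs_def)
  qed (simp add: obs_def)
  then show ?thesis
    using assms unfolding max_obs_def hit_def by (subst Max_le_iff) auto
qed

end

subsection \<open>The limit law\<close>

text \<open>The logarithm n ln(1 - t) is the product of n t and ln(1 - t) / t, whose limits are l
  and -1.\<close>

lemma power_one_minus_tendsto_exp:
  fixes t :: "nat \<Rightarrow> real"
  assumes "(\<lambda>n. real n * t n) \<longlonglongrightarrow> l" "t \<longlonglongrightarrow> 0" "\<forall>\<^sub>F n in sequentially. 0 < t n"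
  shows "(\<lambda>n. (1 - t n) ^ n) \<longlonglongrightarrow> exp (- l)"
proof -
  have "((\<lambda>x::real. ln (1 - x) / x) \<longlongrightarrow> - 1) (at_right 0)" by real_asymp
  moreover have "filterlim t (at_right 0) sequentially"
    using assms by (simp add: filterlim_at_right_to_0 filterlim_at eventually_mono)
  ultimately have "(\<lambda>n. ln (1 - t n) / t n) \<longlonglongrightarrow> - 1"
    by (rule filterlim_compose)
  from tendsto_exp[OF tendsto_mult[OF assms(1) this]]
  have "(\<lambda>n. exp (real n * t n * (ln (1 - t n) / t n))) \<longlonglongrightarrow> exp (- l)" by simp
  moreover have "\<forall>\<^sub>F n in sequentially. t n < 1"
    using assms(2) by (rule order_tendstoD) simp
  then have "\<forall>\<^sub>F n in sequentially. exp (real n * t n * (ln (1 - t n) / t n)) = (1 - t n) ^ n"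
    using assms(3)
  proof eventually_elim
    case (elim n)
    then have "exp (real n * t n * (ln (1 - t n) / t n)) = exp (real n * ln (1 - t n))" by simp
    also have "\<dots> = (1 - t n) ^ n" using elim by (simp add: exp_of_nat_mult)
    finally show ?case .
  qed
  ultimately show ?thesis by (rule Lim_transform_eventually)
qed

context baker_srb
begin

lemma prob_sq_ball_mono: "r \<le> s \<Longrightarrow> prob (sq_ball z r) \<le> prob (sq_ball z s)"
  unfolding prob_hit[of z _ 0, symmetric]
  by (intro finite_measure_mono sets_muI) (auto simp: hit_0)

text \<open>The abscissa factor is bounded by 1. This crude bound suffices to pass from k r
  \<longlonglongrightarrow> 0 to k times the ball mass tending to 0.\<close>

lemma prob_sq_ball_le: "0 < r \<Longrightarrow> prob (sq_ball z r) \<le> 2 * r"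
  unfolding prob_sq_ball
  using mult_mono[of "prob {w \<in> square. fst w \<in> {x. \<bar>x - fst z\<bar> < r}}" 1] unif_interval_le[of r "snd z"]
  by fastforce

lemma prob_sq_ball_lower:
  assumes "((\<lambda>r. ln (prob (sq_ball z r)) / ln r) \<longlongrightarrow> baker_dim \<gamma>) (at_right 0)"
  shows "\<forall>\<^sub>F r in at_right 0. r powr (baker_dim \<gamma> + 1) < prob (sq_ball z r)"
proof -
  have "0 < baker_dim \<gamma>"
    unfolding baker_dim_def using gamma_pos gamma_less
    by (intro add_pos_pos divide_pos_pos) (auto intro!: ln_gt_zero simp: field_simps)
  \<comment> \<open>Positivity of the quotient excludes balls of measure zero, for which the library
    value \<open>ln 0 = 0\<close> would make it 0.\<close>
  then have "\<forall>\<^sub>F r in at_right 0. 0 < ln (prob (sq_ball z r)) / ln r"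
    "\<forall>\<^sub>F r in at_right 0. ln (prob (sq_ball z r)) / ln r < baker_dim \<gamma> + 1"
    using order_tendstoD[OF assms] by auto
  moreover have "\<forall>\<^sub>F r::real in at_right 0. 0 < r \<and> r < 1"
    by (auto simp: eventually_at_right_field intro!: exI[of _ 1])
  ultimately show ?thesis
  proof eventually_elim
    case (elim r)
    then have "prob (sq_ball z r) \<noteq> 0" by auto
    then have pos: "0 < prob (sq_ball z r)" using measure_nonneg[of \<mu>] by (simp add: order_less_le)
    have "ln r < 0" using elim by simp
    then have "(baker_dim \<gamma> + 1) * ln r < ln (prob (sq_ball z r))"
      using elim(2) by (simp add: neg_divide_less_eq)
    then have "exp ((baker_dim \<gamma> + 1) * ln r) < prob (sq_ball z r)"
      using pos by (metis exp_less_cancel_iff exp_ln)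
    then show ?case using elim by (simp add: powr_def)
  qed
qed

text \<open>The dimension hypothesis only enters through a polynomial lower bound for the measure of
  balls: it makes \<open>n\<close> at most polynomial in \<open>1/r\<close>, so that a gap of \<open>r powr (-1/2)\<close> steps is long
  enough for decorrelation, yet too short to see a second visit to the ball.\<close>

lemma survival_tendsto:
  assumes z: "z \<in> square" and per: "has_minimal_period (baker \<gamma>) z p"
    and lower: "\<forall>\<^sub>F r in at_right 0. r powr D < prob (sq_ball z r)"
    and \<tau>: "0 < \<tau>" and r: "\<And>n. 0 < r n"
    and lim: "(\<lambda>n. real n * prob (sq_ball z (r n))) \<longlonglongrightarrow> \<tau>"
  shows "(\<lambda>n. survival z (r n) n) \<longlonglongrightarrow> exp (- (1 - (1/2) ^ p) * \<tau>)"
proof -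
  let ?b = "\<lambda>n. prob (sq_ball z (r n))" and ?\<theta> = "1 - (1/2) ^ p :: real"
  obtain C where C: "0 < C" "\<And>k a. prob {w \<in> square. \<bar>fst w - a\<bar> \<le> \<gamma> ^ k} \<le> C / 2 ^ k"
    using prob_fst_near by blast
  have p: "0 < p" using per by (simp add: has_minimal_period_def)
  have "(1/2 :: real) ^ p \<le> (1/2) ^ 1" using p by (intro power_decreasing) auto
  then have \<theta>: "0 < ?\<theta>" by simp
  have "(\<lambda>n. real n * ?b n * (1 / real n)) \<longlonglongrightarrow> \<tau> * 0"
    by (intro tendsto_mult lim lim_1_over_n)
  moreover have "\<forall>\<^sub>F n in sequentially. real n * ?b n * (1 / real n) = ?b n"
    using eventually_gt_at_top[of 0] by eventually_elim simp
  ultimately have b0: "?b \<longlonglongrightarrow> 0" using Lim_transform_eventually by fastforce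
  \<comment> \<open>There are arbitrarily small balls of positive mass, while the masses
    \<open>?b n\<close> tend to 0; monotonicity in the radius forces the radii to 0.\<close>
  have "\<forall>\<^sub>F n in sequentially. r n < \<epsilon>" if "0 < \<epsilon>" for \<epsilon>
  proof -
    have "\<forall>\<^sub>F s in at_right 0. 0 < s \<and> s < \<epsilon>"
      using that by (auto simp: eventually_at_right_field intro!: exI[of _ \<epsilon>])
    then have "\<forall>\<^sub>F s in at_right 0. (0 < s \<and> s < \<epsilon>) \<and> s powr D < prob (sq_ball z s)"
      using lower by (rule eventually_conj)
    then obtain s where s: "0 < s" "s < \<epsilon>" "s powr D < prob (sq_ball z s)"
      using eventually_happens[of _ "at_right (0::real)"] by force
    then have "0 < prob (sq_ball z s)" by (smt (verit) powr_ge_zero)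
    then have "\<forall>\<^sub>F n in sequentially. ?b n < prob (sq_ball z s)" by (rule order_tendstoD(2)[OF b0])
    then show ?thesis
    proof eventually_elim
      case (elim n)
      have "r n < s" using elim prob_sq_ball_mono[of s "r n" z] by linarith
      then show ?case using s(2) by simp
    qed
  qed
  then have r0: "filterlim r (at_right 0) sequentially"
    using r by (simp add: filterlim_at tendsto_iff abs_of_pos less_imp_neq[THEN not_sym])
  have bpos: "\<forall>\<^sub>F n in sequentially. r n powr D < ?b n"
    using filterlim_iff[THEN iffD1, OF r0] lower by blast
  define k where "k n = nat \<lfloor>r n powr (-1/2)\<rfloor>" for n
  have k_le: "real (k n) \<le> r n powr (-1/2)" for n unfolding k_def by simp
  have k_ge: "2 powr (r n powr (-1/2) - 1) \<le> 2 ^ k n" for n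
  proof -
    have "r n powr (-1/2) - 1 \<le> real (k n)" unfolding k_def by linarith
    then have "2 powr (r n powr (-1/2) - 1) \<le> 2 powr real (k n)" by (rule powr_mono) simp
    then show ?thesis by (simp add: powr_realpow)
  qed
  have "((\<lambda>x::real. x powr (-1/2) * x) \<longlongrightarrow> 0) (at_right 0)" by real_asymp
  from filterlim_compose[OF this r0] have "(\<lambda>n. r n powr (-1/2) * r n) \<longlonglongrightarrow> 0" .
  then have kr: "(\<lambda>n. real (k n) * r n) \<longlonglongrightarrow> 0"
    by (rule Lim_null_comparison[rotated]) (use k_le r in \<open>auto intro!: always_eventually mult_right_mono simp: less_imp_le\<close>)
  have kb: "(\<lambda>n. real (k n) * ?b n) \<longlonglongrightarrow> 0"
  proof (rule Lim_null_comparison)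
    show "(\<lambda>n. 2 * (real (k n) * r n)) \<longlonglongrightarrow> 0"
      using tendsto_mult[OF tendsto_const[of 2] kr] by simp
    have "real (k n) * ?b n \<le> 2 * (real (k n) * r n)" for n
      using mult_left_mono[OF prob_sq_ball_le[OF r], of "real (k n)" z n] by simp
    then show "\<forall>\<^sub>F n in sequentially. norm (real (k n) * ?b n) \<le> 2 * (real (k n) * r n)"
      by simp
  qed
  have "filterlim (\<lambda>x::real. x powr (-1/2) - 1) at_top (at_right 0)" by real_asymp
  from filterlim_compose[OF this r0] have "filterlim (\<lambda>n. r n powr (-1/2) - 1) at_top sequentially" .
  moreover have "\<forall>\<^sub>F n in sequentially. r n powr (-1/2) - 1 \<le> real (k n)"
    unfolding k_def by (intro always_eventually allI) linarith
  ultimately have "filterlim (\<lambda>n. real (k n)) at_top sequentially"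
    by (rule filterlim_at_top_mono)
  then have kp: "\<forall>\<^sub>F n in sequentially. p < 2 * k n"
    by (auto simp: filterlim_at_top_dense dest!: spec[of _ "real p"] elim!: eventually_mono)
  \<comment> \<open>Eventually n is at most 2 \<tau> r^-D, while 2^k is at least 2^(r^(-1/2) - 1),
    which beats every power of 1/r.\<close>
  have "((\<lambda>x::real. (4 * \<tau>\<^sup>2) * (x powr (- (2 * D)) / 2 powr (x powr (-1/2) - 1))) \<longlongrightarrow> 0) (at_right 0)"
    using \<tau> by real_asymp
  from filterlim_compose[OF this r0]
  have "(\<lambda>n. (4 * \<tau>\<^sup>2) * (r n powr (- (2 * D)) / 2 powr (r n powr (-1/2) - 1))) \<longlonglongrightarrow> 0" .
  moreover have "\<forall>\<^sub>F n in sequentially. real n * ?b n < 2 * \<tau>"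
    using \<tau> by (intro order_tendstoD[OF lim]) simp
  then have "\<forall>\<^sub>F n in sequentially. norm (real n ^ 2 / 2 ^ k n) \<le> (4 * \<tau>\<^sup>2) * (r n powr (- (2 * D)) / 2 powr (r n powr (-1/2) - 1))"
    using bpos
  proof eventually_elim
    case (elim n)
    have "real n * r n powr D \<le> real n * ?b n" using elim by (intro mult_left_mono) auto
    then have "real n \<le> 2 * \<tau> * r n powr (- D)"
      using elim r[of n] by (simp add: powr_minus field_simps)
    then have "real n ^ 2 \<le> (2 * \<tau> * r n powr (- D)) ^ 2" by (intro power_mono) auto
    also have "\<dots> = 4 * \<tau>\<^sup>2 * r n powr (- (2 * D))"
      using r[of n] by (simp add: power_mult_distrib power2_eq_square flip: powr_add)
    finally have "real n ^ 2 / 2 ^ k n \<le> 4 * \<tau>\<^sup>2 * r n powr (- (2 * D)) / 2 powr (r n powr (-1/2) - 1)"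
      using k_ge[of n] by (intro frac_le) auto
    then show ?case by simp
  qed
  ultimately have nk: "(\<lambda>n. real n ^ 2 / 2 ^ k n) \<longlonglongrightarrow> 0"
    by (rule Lim_null_comparison[rotated])
  have "real n \<le> real n ^ 2" for n
    unfolding power2_eq_square of_nat_mult[symmetric] of_nat_le_iff by (rule le_square)
  then have "\<forall>\<^sub>F n in sequentially. norm (real n / 2 ^ k n) \<le> real n ^ 2 / 2 ^ k n"
    by (intro always_eventually allI) (simp add: divide_right_mono)
  then have nk': "(\<lambda>n. real n / 2 ^ k n) \<longlonglongrightarrow> 0"
    using nk by (rule Lim_null_comparison)
  define err where "err K n = real n * (?b n * (4 * real (k n) * r n + 2 / 2 ^ K) + real n * (4 * C / 2 ^ k n)
             + 4 / 2 ^ k n + 2 * real (k n) * ?b n ^ 2) + 2 * real (k n) * ?b n" for K n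
  \<comment> \<open>For fixed K only the geometric tail of gap returns after time K survives in the
    limit.\<close>
  have err: "err K \<longlonglongrightarrow> \<tau> * (2 / 2 ^ K)" for K
  proof -
    have "(\<lambda>n. (real n * ?b n) * (4 * (real (k n) * r n) + 2 / 2 ^ K) + (4 * C) * (real n ^ 2 / 2 ^ k n)
        + 4 * (real n / 2 ^ k n) + 2 * (real n * ?b n) * (real (k n) * ?b n) + 2 * (real (k n) * ?b n))
      \<longlonglongrightarrow> \<tau> * (4 * 0 + 2 / 2 ^ K) + (4 * C) * 0 + 4 * 0 + 2 * \<tau> * 0 + 2 * 0"
      by (intro tendsto_intros lim kr kb nk nk')
    moreover have "err K = (\<lambda>n. (real n * ?b n) * (4 * (real (k n) * r n) + 2 / 2 ^ K) + (4 * C) * (real n ^ 2 / 2 ^ k n)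
        + 4 * (real n / 2 ^ k n) + 2 * (real n * ?b n) * (real (k n) * ?b n) + 2 * (real (k n) * ?b n))"
      unfolding err_def by (simp add: fun_eq_iff algebra_simps power2_eq_square)
    ultimately show ?thesis by simp
  qed
  have "(\<lambda>n. survival z (r n) n - (1 - ?\<theta> * ?b n) ^ n) \<longlonglongrightarrow> 0"
  proof (rule tendstoI)
    fix \<epsilon> :: real assume \<epsilon>: "0 < \<epsilon>"
    \<comment> \<open>Order of choices: \<epsilon> determines K, then K determines \<delta>, and
      only then n tends to infinity.\<close>
    have "(\<lambda>K. \<tau> * 2 * (1/2) ^ K) \<longlonglongrightarrow> \<tau> * 2 * 0"
      by (intro tendsto_mult tendsto_const LIMSEQ_realpow_zero) auto
    then have "\<forall>\<^sub>F K in sequentially. \<tau> * 2 * (1/2) ^ K < \<epsilon>"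
      using \<epsilon> by (intro order_tendstoD) auto
    then have "\<forall>\<^sub>F K in sequentially. \<tau> * 2 * (1/2) ^ K < \<epsilon> \<and> p \<le> K"
      using eventually_ge_at_top[of p] by (rule eventually_conj)
    then obtain K where K: "\<tau> * (2 / 2 ^ K) < \<epsilon>" "p \<le> K"
      by (auto simp: eventually_sequentially power_one_over)
    obtain \<delta> where \<delta>: "0 < \<delta>" "\<And>r k n. 0 < r \<Longrightarrow> r < \<delta> \<Longrightarrow> p < 2 * k \<Longrightarrow>
      \<bar>survival z r n - (1 - ?\<theta> * prob (sq_ball z r)) ^ n\<bar>
        \<le> real n * (prob (sq_ball z r) * (4 * real k * r + 2 / 2 ^ K) + real n * (4 * C / 2 ^ k)
             + 4 / 2 ^ k + 2 * real k * prob (sq_ball z r) ^ 2)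
          + 2 * real k * prob (sq_ball z r)"
      using survival_estimate[OF C(2) z per K(2)] by metis
    have "\<forall>\<^sub>F n in sequentially. r n < \<delta>"
      using r0 \<delta>(1) by (auto simp: filterlim_at intro: order_tendstoD)
    moreover have "\<forall>\<^sub>F n in sequentially. err K n < \<epsilon>"
      by (rule order_tendstoD(2)[OF err K(1)])
    ultimately show "\<forall>\<^sub>F n in sequentially. dist (survival z (r n) n - (1 - ?\<theta> * ?b n) ^ n) 0 < \<epsilon>"
      using kp
    proof eventually_elim
      case (elim n)
      then show ?case using \<delta>(2)[OF r elim(1) elim(3), of n] unfolding err_def by (simp add: dist_real_def)
    qed
  qed
  moreover have "(\<lambda>n. (1 - ?\<theta> * ?b n) ^ n) \<longlonglongrightarrow> exp (- (?\<theta> * \<tau>))"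
  proof (rule power_one_minus_tendsto_exp)
    show "(\<lambda>n. real n * (?\<theta> * ?b n)) \<longlonglongrightarrow> ?\<theta> * \<tau>"
      using tendsto_mult[OF tendsto_const[of ?\<theta>] lim] by (simp add: mult_ac)
    show "(\<lambda>n. ?\<theta> * ?b n) \<longlonglongrightarrow> 0"
      using tendsto_mult[OF tendsto_const[of ?\<theta>] b0] by simp
    show "\<forall>\<^sub>F n in sequentially. 0 < ?\<theta> * ?b n"
      using bpos
    proof eventually_elim
      case (elim n)
      then have "0 < ?b n" by (smt (verit) powr_ge_zero)
      then show ?case using \<theta> by (rule mult_pos_pos[rotated])
    qed
  qed
  ultimately have "(\<lambda>n. (survival z (r n) n - (1 - ?\<theta> * ?b n) ^ n) + (1 - ?\<theta> * ?b n) ^ n) \<longlonglongrightarrow> 0 + exp (- (?\<theta> * \<tau>))"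
    by (rule tendsto_add)
  then show ?thesis by (simp only: diff_add_cancel add_0 mult_minus_left)
qed

end

theorem proposition7p3:
  fixes \<gamma> \<tau> :: real and \<mu> :: "(real \<times> real) measure" and z :: "real \<times> real"
    and p :: nat and u :: "nat \<Rightarrow> real"
  assumes "0 < \<gamma>" and "\<gamma> < 1/2"
    and "is_SRB \<gamma> \<mu>"
    and "z \<in> square" and "has_minimal_period (baker \<gamma>) z p"
    and "((\<lambda>r. ln (measure \<mu> (sq_ball z r)) / ln r) \<longlongrightarrow> baker_dim \<gamma>) (at_right 0)"
    and "0 < \<tau>"
    and "(\<lambda>n. real n * measure \<mu> (sq_ball z (exp (- u n)))) \<longlonglongrightarrow> \<tau>"
  shows "(\<lambda>n. measure \<mu> {x \<in> space \<mu>. max_obs (baker \<gamma>) z n x \<le> ereal (u n)})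
           \<longlonglongrightarrow> exp (- (1 - (1/2) ^ p) * \<tau>)"
proof -
  interpret baker_srb \<gamma> \<mu> using assms by unfold_locales
  have "(\<lambda>n. survival z (exp (- u n)) n) \<longlonglongrightarrow> exp (- (1 - (1/2) ^ p) * \<tau>)"
    using assms by (intro survival_tendsto[OF _ _ prob_sq_ball_lower]) auto
  moreover have "\<forall>\<^sub>F n in sequentially. survival z (exp (- u n)) n =
      measure \<mu> {x \<in> space \<mu>. max_obs (baker \<gamma>) z n x \<le> ereal (u n)}"
    \<comment> \<open>For n = 0 the maximum is over an empty set, so the two sides are compared only
      for positive n.\<close>
    using eventually_gt_at_top[of 0]
    by eventually_elim (simp add: survival_def max_obs_le_iff)
  ultimately show ?thesis by (rule Lim_transform_eventually)
qed

end
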